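(* Suppose (a) $(M_1,\Gamma_1,\sigma_1,\mu_1)$ is a well-behaved Patterson--Sullivan system of dimension $\delta_1$ with respect to a hierarchy $\mathscr{H}_1=\{\mathscr{H}_1(R)\subset\Gamma_1:R\ge0\}$ and $\mu_1(\Lambda^{\rm con}(\mathscr{H}_1))=1$; (b) $(M_2,\Gamma_2,\sigma_2,\mu_2)$ is a Patterson--Sullivan system of dimension $\delta_2$; (c) there exists an onto homomorphism $\rho:\Gamma_1\to\Gamma_2$ and a $\mu_1$-a.e. defined measurable $\rho$-equivariant injective map $f:M_1\to M_2$. If the measures $f_*\mu_1$ and $\mu_2$ are not singular, then $$\sup_{\gamma\in\Gamma_1}\left|\delta_1\|\gamma\|_{\sigma_1}-\delta_2\|\rho(\gamma)\|_{\sigma_2}\right|<+\infty.$$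
   Context: Let $M$ be a compact metrizable space (with a fixed compatible metric, used for diameters and Hausdorff distance) and $\Gamma<\mathsf{Homeo}(M)$ a subgroup. A function $\sigma:\Gamma\times M\to\mathbb{R}$ is a coarse-cocycle if for some $\kappa\ge0$, $|\sigma(\gamma_1\gamma_2,x)-(\sigma(\gamma_1,\gamma_2x)+\sigma(\gamma_2,x))|\le\kappa$ for all $\gamma_1,\gamma_2\in\Gamma$, $x\in M$. A Borel probability measure $\mu$ on $M$ is a coarse $\sigma$-Patterson--Sullivan measure of dimension $\delta\ge0$ if there is $C\ge1$ such that for all $\gamma\in\Gamma$, $\mu,\gamma_*\mu$ are mutually absolutely continuous and $C^{-1}e^{-\delta\sigma(\gamma^{-1},x)}\le\frac{d\gamma_*\mu}{d\mu}(x)\le Ce^{-\delta\sigma(\gamma^{-1},x)}$ for $\mu$-a.e. $x$. A Patterson--Sullivan system (PS-system) $(M,\Gamma,\sigma,\mu)$ of dimension $\delta$ consists of a coarse-cocycle $\sigma$, a coarse $\sigma$-Patterson--Sullivan measure $\mu$ of dimension $\delta$, for each $\gamma\in\Gamma$ a number $\|\gamma\|_\sigma\in\mathbb{R}$ (the magnitude), and for each $\gamma\in\Gamma$, $R>0$ a non-empty open set $\mathcal{O}_R(\gamma)\subset M$ (the $R$-shadow), such that: (PS1) For each $\gamma\in\Gamma$ there is $c(\gamma)>0$ with $|\sigma(\gamma,x)|\le c(\gamma)$ for $\mu$-a.e. $x$. (PS2) For every $R>0$ there is $C(R)>0$ with $\|\gamma\|_\sigma-C\le\sigma(\gamma,x)\le\|\gamma\|_\sigma+C$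 for all $\gamma\in\Gamma$ and $\mu$-a.e. $x\in\gamma^{-1}\mathcal{O}_R(\gamma)$. (PS3) If $\{\gamma_n\}\subset\Gamma$, $R_n\to+\infty$, $Z\subset M$ is compact and $[M\smallsetminus\gamma_n^{-1}\mathcal{O}_{R_n}(\gamma_n)]\to Z$ in the Hausdorff distance, then for any $x\in Z$ there is $g\in\Gamma$ with $gx\notin Z$. (Convention: $C_n\to\emptyset$ iff $C_n=\emptyset$ for all large $n$.) It is well-behaved with respect to a hierarchy $\mathscr{H}=\{\mathscr{H}(R)\subset\Gamma:R\ge0\}$, i.e. a collection of subsets non-increasing in $R$, if moreover: (PS4) $\Gamma$ is countable and for any $T>0$ the set $\{\gamma\in\mathscr{H}(0):\|\gamma\|_\sigma\le T\}$ is finite. (PS5) If $\{\gamma_n\},R_n,Z$ are as in (PS3), then for any $h_1,\dots,h_m\in\Gamma$ and $x\in Z$ there is $g\in\Gamma$ with $gx\notin\bigcup_{i=1}^mh_iZ$. (PS6) If $R_1\le R_2$ and $\gamma\in\mathscr{H}(0)$, then $\mathcal{O}_{R_1}(\gamma)\subset\mathcal{O}_{R_2}(\gamma)$. (PS7) For any $R>0$ there are $C>0$, $R'>0$ such that: if $\alpha,\beta\in\mathscr{H}(R)$, $\|\alpha\|_\sigma\le\|\beta\|_\sigma$ and $\mathcal{O}_R(\alpha)\cap\mathcal{O}_R(\beta)\ne\emptyset$, then $\mathcal{O}_R(\beta)\subset\mathcal{O}_{R'}(\alpha)$ and $|\|\beta\|_\sigma-(\|\alpha\|_\sigma+\|\alpha^{-1}\beta\|_\sigma)|\le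 C$. (PS8) For every $R>0$ there is $M'\subset M$ of full $\mu$-measure such that $\lim_n\mathrm{diam}\,\mathcal{O}_R(\gamma_n)=0$ whenever $\{\gamma_n\}\subset\mathscr{H}(R)$ is an escaping sequence and $x\in M'\cap\bigcap_{n\ge1}\mathcal{O}_R(\gamma_n)$. A sequence is escaping if it eventually leaves every finite set. The $\mathscr{H}$-conical limit set $\Lambda^{\rm con}(\mathscr{H})$ is the set of $x\in M$ for which there are $R>0$, $\gamma\in\Gamma$ and an escaping sequence $\{\gamma_n\}$ with $\gamma_n\in\mathscr{H}(n)$ such that $x\in\gamma\mathcal{O}_R(\gamma_n)$ for all $n\ge1$. An a.e. defined measurable $\rho$-equivariant injective map means: there is a measurable $\Gamma_1$-invariant set $Y\subset M_1$ of full $\mu_1$-measure and a measurable injective $f:Y\to M_2$ with $f(\gamma y)=\rho(\gamma)f(y)$ for all $\gamma\in\Gamma_1$, $y\in Y$. *)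

theory Defs
  imports "HOL-Probability.Probability" "HOL-Algebra.Group"
begin

definition homeo_group :: "('a::topological_space \<Rightarrow> 'a) monoid" where
  "homeo_group =
     \<lparr>carrier = {g. \<exists>h. homeomorphism UNIV UNIV g h}, mult = (\<circ>), one = id\<rparr>"

lemma group_homeo_group: "group (homeo_group :: ('a::topological_space \<Rightarrow> 'a) monoid)"
proof (rule groupI)
  fix x y :: "'a \<Rightarrow> 'a"
  assume "x \<in> carrier homeo_group" "y \<in> carrier homeo_group"
  then show "x \<otimes>\<^bsub>homeo_group\<^esub> y \<in> carrier homeo_group"
    by (auto simp: homeo_group_def intro: homeomorphism_compose)
next
  fix x :: "'a \<Rightarrow> 'a"
  assume "x \<in> carrier homeo_group"
  then obtain h where h: "homeomorphism UNIV UNIV x h"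
    by (auto simp: homeo_group_def)
  then have "h \<circ> x = id"
    by (auto simp: homeomorphism_def)
  with homeomorphism_symD[OF h]
  show "\<exists>y\<in>carrier homeo_group. y \<otimes>\<^bsub>homeo_group\<^esub> x = \<one>\<^bsub>homeo_group\<^esub>"
    by (auto simp: homeo_group_def)
qed (auto simp: homeo_group_def homeomorphism_def intro!: exI[of _ id])

lemma m_inv_homeo_group:
  assumes "g \<in> carrier homeo_group"
  shows "inv\<^bsub>homeo_group\<^esub> g = inv_into UNIV g"
proof -
  from assms obtain h where h: "homeomorphism UNIV UNIV g h"
    by (auto simp: homeo_group_def)
  then have hg: "h \<circ> g = id" and gh: "g \<circ> h = id"
    by (auto simp: homeomorphism_def)
  have "h \<in> carrier homeo_group"
    using homeomorphism_symD[OF h] by (auto simp: homeo_group_def)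
  then have "inv\<^bsub>homeo_group\<^esub> g = h"
    using group.inv_equality[OF group_homeo_group, of h g] assms hg
    by (simp add: homeo_group_def)
  moreover have "inv_into UNIV g = h"
    using hg gh by (rule inv_unique_comp[rotated])
  ultimately show ?thesis by simp
qed

definition coarse_cocycle ::
  "('a \<Rightarrow> 'a) set \<Rightarrow> (('a \<Rightarrow> 'a) \<Rightarrow> 'a \<Rightarrow> real) \<Rightarrow> bool" where
  "coarse_cocycle \<Gamma> \<sigma> \<longleftrightarrow>
     (\<exists>\<kappa>\<ge>0. \<forall>\<gamma>\<^sub>1\<in>\<Gamma>. \<forall>\<gamma>\<^sub>2\<in>\<Gamma>. \<forall>x.
        \<bar>\<sigma> (\<gamma>\<^sub>1 \<circ> \<gamma>\<^sub>2) x - (\<sigma> \<gamma>\<^sub>1 (\<gamma>\<^sub>2 x) + \<sigma> \<gamma>\<^sub>2 x)\<bar> \<le> \<kappa>)"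

definition coarse_PS_measure ::
  "('a::topological_space \<Rightarrow> 'a) set \<Rightarrow> (('a \<Rightarrow> 'a) \<Rightarrow> 'a \<Rightarrow> real) \<Rightarrow>
    'a measure \<Rightarrow> real \<Rightarrow> bool" where
  "coarse_PS_measure \<Gamma> \<sigma> \<mu> \<delta> \<longleftrightarrow>
     prob_space \<mu> \<and> sets \<mu> = sets borel \<and> \<delta> \<ge> 0 \<and>
     (\<exists>C\<ge>1. \<forall>\<gamma>\<in>\<Gamma>.
        absolutely_continuous \<mu> (distr \<mu> borel \<gamma>) \<and>
        absolutely_continuous (distr \<mu> borel \<gamma>) \<mu> \<and>
        (AE x in \<mu>.
           ennreal (inverse C * exp (- \<delta> * \<sigma> (inv_into UNIV \<gamma>) x))
             \<le> RN_deriv \<mu> (distr \<mu> borel \<gamma>) x \<and>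
           RN_deriv \<mu> (distr \<mu> borel \<gamma>) x
             \<le> ennreal (C * exp (- \<delta> * \<sigma> (inv_into UNIV \<gamma>) x))))"

text \<open>
  On bounded non-empty sets, which are the only sets it is applied to below, this is the
  usual real-valued Hausdorff distance.
\<close>

definition hausdorff_dist :: "'a::metric_space set \<Rightarrow> 'a set \<Rightarrow> real" where
  "hausdorff_dist A B = max (SUP a\<in>A. infdist a B) (SUP b\<in>B. infdist b A)"

text \<open>
  The empty set is treated as an isolated point: a sequence of sets converges to the
  empty set iff its members are eventually empty.
\<close>

definition hausdorff_tendsto :: "(nat \<Rightarrow> 'a::metric_space set) \<Rightarrow> 'a set \<Rightarrow> bool" where
  "hausdorff_tendsto A Z \<longleftrightarrow>
     (if Z = {} then eventually (\<lambda>n. A n = {}) sequentially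
      else eventually (\<lambda>n. A n \<noteq> {}) sequentially \<and>
           (\<lambda>n. hausdorff_dist (A n) Z) \<longlonglongrightarrow> 0)"

text \<open>The common hypothesis of the third and the fifth axiom below.\<close>

definition shadow_complements_tendsto ::
  "('a::metric_space \<Rightarrow> 'a) set \<Rightarrow> (real \<Rightarrow> ('a \<Rightarrow> 'a) \<Rightarrow> 'a set) \<Rightarrow>
    (nat \<Rightarrow> 'a \<Rightarrow> 'a) \<Rightarrow> (nat \<Rightarrow> real) \<Rightarrow> 'a set \<Rightarrow> bool" where
  "shadow_complements_tendsto \<Gamma> shadow g R Z \<longleftrightarrow>
     (\<forall>n. g n \<in> \<Gamma>) \<and> (\<forall>n. R n > 0) \<and> filterlim R at_top sequentially \<and>
     compact Z \<and> hausdorff_tendsto (\<lambda>n. UNIV - g n -` shadow (R n) (g n)) Z"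

definition escaping :: "(nat \<Rightarrow> 'b) \<Rightarrow> bool" where
  "escaping s \<longleftrightarrow> (\<forall>F. finite F \<longrightarrow> eventually (\<lambda>n. s n \<notin> F) sequentially)"

text \<open>
  The space \<open>M\<close> is the whole type. The values of \<open>\<sigma>\<close>, \<open>mag\<close> and \<open>shadow\<close> outside \<open>\<Gamma>\<close>, and
  of \<open>shadow R\<close> for \<open>R \<le> 0\<close>, are irrelevant.
\<close>

locale PS_system =
  fixes \<Gamma> :: "('a::metric_space \<Rightarrow> 'a) set"
    and \<sigma> :: "('a \<Rightarrow> 'a) \<Rightarrow> 'a \<Rightarrow> real"
    and \<mu> :: "'a measure"
    and \<delta> :: real
    and mag :: "('a \<Rightarrow> 'a) \<Rightarrow> real"
    and shadow :: "real \<Rightarrow> ('a \<Rightarrow> 'a) \<Rightarrow> 'a set"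
  assumes compact_space: "compact (UNIV :: 'a set)"
    and subgroup: "subgroup \<Gamma> homeo_group"
    and cocycle: "coarse_cocycle \<Gamma> \<sigma>"
    and PS_measure: "coarse_PS_measure \<Gamma> \<sigma> \<mu> \<delta>"
    and shadow_open: "\<And>\<gamma> R. \<gamma> \<in> \<Gamma> \<Longrightarrow> R > 0 \<Longrightarrow> open (shadow R \<gamma>) \<and> shadow R \<gamma> \<noteq> {}"
    and PS1: "\<And>\<gamma>. \<gamma> \<in> \<Gamma> \<Longrightarrow> \<exists>c>0. AE x in \<mu>. \<bar>\<sigma> \<gamma> x\<bar> \<le> c"
    and PS2: "\<And>R. R > 0 \<Longrightarrow>
      \<exists>C>0. \<forall>\<gamma>\<in>\<Gamma>. AE x in \<mu>. x \<in> \<gamma> -` shadow R \<gamma> \<longrightarrow>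
        mag \<gamma> - C \<le> \<sigma> \<gamma> x \<and> \<sigma> \<gamma> x \<le> mag \<gamma> + C"
    and PS3: "\<And>g R Z x. shadow_complements_tendsto \<Gamma> shadow g R Z \<Longrightarrow> x \<in> Z \<Longrightarrow>
      \<exists>h\<in>\<Gamma>. h x \<notin> Z"

definition hierarchy :: "'b set \<Rightarrow> (real \<Rightarrow> 'b set) \<Rightarrow> bool" where
  "hierarchy \<Gamma> H \<longleftrightarrow>
     (\<forall>R\<ge>0. H R \<subseteq> \<Gamma>) \<and> (\<forall>R S. 0 \<le> R \<and> R \<le> S \<longrightarrow> H S \<subseteq> H R)"

locale well_behaved_PS_system = PS_system +
  fixes H :: "real \<Rightarrow> ('a::metric_space \<Rightarrow> 'a) set"
  assumes hierarchy: "hierarchy \<Gamma> H"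
    and PS4_countable: "countable \<Gamma>"
    and PS4_finite: "\<And>T. T > 0 \<Longrightarrow> finite {\<gamma> \<in> H 0. mag \<gamma> \<le> T}"
    and PS5: "\<And>g R Z F x. shadow_complements_tendsto \<Gamma> shadow g R Z \<Longrightarrow>
      finite F \<Longrightarrow> F \<subseteq> \<Gamma> \<Longrightarrow> x \<in> Z \<Longrightarrow> \<exists>k\<in>\<Gamma>. k x \<notin> (\<Union>h\<in>F. h ` Z)"
    and PS6: "\<And>R\<^sub>1 R\<^sub>2 \<gamma>. 0 < R\<^sub>1 \<Longrightarrow> R\<^sub>1 \<le> R\<^sub>2 \<Longrightarrow> \<gamma> \<in> H 0 \<Longrightarrow>
      shadow R\<^sub>1 \<gamma> \<subseteq> shadow R\<^sub>2 \<gamma>"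
    and PS7: "\<And>R. R > 0 \<Longrightarrow> \<exists>C>0. \<exists>R'>0. \<forall>\<alpha>\<in>H R. \<forall>\<beta>\<in>H R.
      mag \<alpha> \<le> mag \<beta> \<and> shadow R \<alpha> \<inter> shadow R \<beta> \<noteq> {} \<longrightarrow>
        shadow R \<beta> \<subseteq> shadow R' \<alpha> \<and>
        \<bar>mag \<beta> - (mag \<alpha> + mag (inv_into UNIV \<alpha> \<circ> \<beta>))\<bar> \<le> C"
    and PS8: "\<And>R. R > 0 \<Longrightarrow> \<exists>M'. (AE x in \<mu>. x \<in> M') \<and>
      (\<forall>g x. (\<forall>n. g n \<in> H R) \<and> escaping g \<and> x \<in> M' \<inter> (\<Inter>n. shadow R (g n)) \<longrightarrow>
        (\<lambda>n. diameter (shadow R (g n))) \<longlonglongrightarrow> 0)"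

definition conical_limit_set ::
  "('a \<Rightarrow> 'a) set \<Rightarrow> (real \<Rightarrow> ('a \<Rightarrow> 'a) \<Rightarrow> 'a set) \<Rightarrow> (real \<Rightarrow> ('a \<Rightarrow> 'a) set) \<Rightarrow> 'a set" where
  "conical_limit_set \<Gamma> shadow H =
     {x. \<exists>R>0. \<exists>\<gamma>\<in>\<Gamma>. \<exists>g. escaping g \<and>
        (\<forall>n\<ge>1. g n \<in> H (real n) \<and> x \<in> \<gamma> ` shadow R (g n))}"

definition ae_equivariant_injection ::
  "('a::topological_space \<Rightarrow> 'a) set \<Rightarrow> 'a measure \<Rightarrow>
    (('a \<Rightarrow> 'a) \<Rightarrow> ('b::topological_space \<Rightarrow> 'b)) \<Rightarrow> 'a set \<Rightarrow> ('a \<Rightarrow> 'b) \<Rightarrow> bool" where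
  "ae_equivariant_injection \<Gamma> \<mu> \<rho> Y f \<longleftrightarrow>
     Y \<in> sets \<mu> \<and> measure \<mu> Y = 1 \<and> (\<forall>\<gamma>\<in>\<Gamma>. \<gamma> ` Y = Y) \<and>
     f \<in> restrict_space \<mu> Y \<rightarrow>\<^sub>M borel \<and> inj_on f Y \<and>
     (\<forall>\<gamma>\<in>\<Gamma>. \<forall>y\<in>Y. f (\<gamma> y) = \<rho> \<gamma> (f y))"

definition mutually_singular :: "'a measure \<Rightarrow> 'a measure \<Rightarrow> bool" where
  "mutually_singular M N \<longleftrightarrow>
     (\<exists>A. A \<in> sets M \<and> A \<in> sets N \<and> emeasure M A = 0 \<and> emeasure N (space N - A) = 0)"

end

theory Submission
  imports Defs "HOL-Library.Diagonal_Subsequence"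
begin

text \<open>
  Let \<open>F\<close> be the density of the absolutely continuous part of \<open>f\<^sub>*\<mu>\<^sub>1\<close> with respect to \<open>\<mu>\<^sub>2\<close>,
  \<open>E\<close> the set where \<open>0 < F \<circ> f < \<infinity>\<close>, and \<open>u = ln (F \<circ> f)\<close> on \<open>E\<close>. Comparing Radon-Nikodym
  derivatives on both sides, \<open>\<delta>\<^sub>1 \<sigma>\<^sub>1(\<gamma>, x) - \<delta>\<^sub>2 \<sigma>\<^sub>2(\<rho> \<gamma>, f x)\<close> agrees with \<open>u x - u (\<gamma> x)\<close> up to
  a constant; this is where injectivity of \<open>f\<close> enters, as it makes every Borel set the preimage of a
  Borel set modulo null sets. Some level set \<open>D\<close> of \<open>u\<close> in \<open>E\<close> contains radial limit points in
  positive measure, so a Vitali argument produces \<open>\<gamma>\<close> such that \<open>\<gamma>\<^sup>-\<^sup>1 D\<close> almost fills the pulled-back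
  shadow \<open>\<gamma>\<^sup>-\<^sup>1 O\<^sub>R(\<gamma>)\<close>. There both cocycles are close to the magnitudes, so \<open>u\<close> is almost constant on
  the part whose image lies in the pulled-back shadow of \<open>\<rho> \<gamma>\<close>. A fixed finite set of translates of
  that part covers \<open>Y\<close>, hence \<open>E\<close> has full measure and \<open>u\<close> is essentially bounded. For arbitrary
  \<open>\<gamma>\<close>, evaluating the comparison of the cocycles at a point in both pulled-back shadows bounds the
  difference of the magnitudes.
\<close>

section \<open>Hausdorff convergence and regularity of Borel measures\<close>

lemma compact_countable_basis:
  assumes "compact (UNIV :: 'a::metric_space set)"
  obtains B :: "nat \<Rightarrow> 'a::metric_space set"
  where "\<And>i. open (B i)" "\<And>U x. open U \<Longrightarrow> x \<in> U \<Longrightarrow> \<exists>i. x \<in> B i \<and> B i \<subseteq> U"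
proof -
  \<comment> \<open>Finite nets at every scale 1/(n+1): total boundedness supplies the countable
    basis, which a metric alone does not give.\<close>
  have "\<exists>k. finite k \<and> (UNIV :: 'a set) \<subseteq> (\<Union>x\<in>k. ball x (inverse (real (Suc n))))" for n
    using compact_imp_seq_compact[OF assms, THEN seq_compact_imp_totally_bounded]
    by (metis inverse_positive_iff_positive of_nat_0_less_iff zero_less_Suc)
  then obtain k :: "nat \<Rightarrow> 'a set" where fin: "\<And>n. finite (k n)"
    and cov: "\<And>n. UNIV \<subseteq> (\<Union>x\<in>k n. ball x (inverse (real (Suc n))))"
    by metis
  \<comment> \<open>Adding the empty set makes the family visibly non-empty, as the enumeration by
    \<open>from_nat_into\<close> requires.\<close>
  define \<B> where "\<B> = insert {} (\<Union>n. (\<lambda>x. ball x (inverse (real (Suc n)))) ` k n)"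
  have "countable \<B>"
    unfolding \<B>_def using fin by (intro countable_insert countable_UN) (auto intro: countable_finite)
  define B where "B = from_nat_into \<B>"
  have B: "\<B> = range B"
    unfolding B_def using \<open>countable \<B>\<close> by (intro range_from_nat_into[symmetric]) (auto simp: \<B>_def)
  show thesis
  proof
    show "open (B i)" for i
    proof -
      have "B i \<in> \<B>" by (simp add: B)
      then show ?thesis by (auto simp: \<B>_def)
    qed
    fix U :: "'a set" and x assume "open U" "x \<in> U"
    then obtain e where "e > 0" and e: "ball x e \<subseteq> U" by (meson openE)
    obtain n where n: "inverse (real (Suc n)) < e / 2"
      using reals_Archimedean[of "e / 2"] \<open>e > 0\<close> by auto
    obtain p where p: "p \<in> k n" "x \<in> ball p (inverse (real (Suc n)))" using cov[of n] by blast
    have "ball p (inverse (real (Suc n))) \<subseteq> ball x e"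
    proof
      fix z assume "z \<in> ball p (inverse (real (Suc n)))"
      then have "dist p z < e / 2" "dist p x < e / 2" using p(2) n by auto
      then show "z \<in> ball x e" using dist_triangle2[of x z p]
        by (simp add: dist_commute)
    qed
    moreover have "ball p (inverse (real (Suc n))) \<in> \<B>" using p(1) by (auto simp: \<B>_def)
    ultimately show "\<exists>i. x \<in> B i \<and> B i \<subseteq> U" using e p(2) unfolding B by blast
  qed
qed

lemma hausdorff_tendsto_subseq:
  assumes "hausdorff_tendsto A Z" "strict_mono r"
  shows "hausdorff_tendsto (A \<circ> r) Z"
proof (cases "Z = {}")
  case True
  then show ?thesis using assms eventually_subseq[of r "\<lambda>n. A n = {}"]
    by (auto simp: hausdorff_tendsto_def)
next
  case False
  then show ?thesis
    using assms eventually_subseq[of r "\<lambda>n. A n \<noteq> {}"]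
      LIMSEQ_subseq_LIMSEQ[of "\<lambda>n. hausdorff_dist (A n) Z" 0 r]
    by (auto simp: hausdorff_tendsto_def o_def)
qed

text \<open>Compactness bounds the distances from above, so the real supremum really dominates each
  of its non-negative members.\<close>

lemma hausdorff_dist_nonneg:
  assumes "compact (UNIV :: 'a::metric_space set)" "(A :: 'a set) \<noteq> {}"
  shows "0 \<le> hausdorff_dist A B"
proof -
  obtain a where a: "a \<in> A" using assms by auto
  have "bdd_above ((\<lambda>a. infdist a B) ` A)"
  proof -
    have "compact ((\<lambda>a. infdist a B) ` UNIV)"
      by (intro compact_continuous_image assms continuous_intros)
    then have "bdd_above ((\<lambda>a. infdist a B) ` UNIV)"
      by (simp add: bounded_imp_bdd_above compact_imp_bounded)
    then show ?thesis by (rule bdd_above_mono) auto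
  qed
  then have "infdist a B \<le> (SUP a\<in>A. infdist a B)" using a by (intro cSUP_upper)
  then show ?thesis using infdist_nonneg[of a B] by (auto simp: hausdorff_dist_def)
qed

text \<open>Blaschke selection. The last conclusion is the form in which convergence is used.\<close>

lemma hausdorff_subsequence:
  fixes A :: "nat \<Rightarrow> 'a::metric_space set"
  assumes cpt: "compact (UNIV :: 'a set)"
  obtains r Z where "strict_mono (r :: nat \<Rightarrow> nat)" "compact Z" "hausdorff_tendsto (A \<circ> r) Z"
    "\<And>x. x \<notin> Z \<Longrightarrow> \<exists>U. open U \<and> x \<in> U \<and> (\<forall>\<^sub>F n in sequentially. A (r n) \<inter> U = {})"
proof -
  obtain B :: "nat \<Rightarrow> 'a set" where opn: "\<And>i. open (B i)"
    and bas: "\<And>U x. open U \<Longrightarrow> x \<in> U \<Longrightarrow> \<exists>i. x \<in> B i \<and> B i \<subseteq> U"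
    using compact_countable_basis[OF cpt] by blast
  \<comment> \<open>Each basic open set poses an alternative that is inherited by subsequences;
    diagonalisation decides all of them along a single subsequence \<open>r\<close>.\<close>
  define P where "P i s \<longleftrightarrow> (\<forall>\<^sub>F n in sequentially. A (s n) \<inter> B i = {}) \<or>
      (\<forall>\<^sub>F n in sequentially. A (s n) \<inter> B i \<noteq> {})" for i and s :: "nat \<Rightarrow> nat"
  interpret subseqs P
  proof
    fix i and s :: "nat \<Rightarrow> nat" assume "strict_mono s"
    show "\<exists>r. strict_mono r \<and> P i (s \<circ> r)"
    proof (cases "finite {n. A (s n) \<inter> B i = {}}")
      case True
      then have "\<forall>\<^sub>F n in sequentially. A (s n) \<inter> B i \<noteq> {}"
        by (simp add: eventually_cofinite flip: cofinite_eq_sequentially)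
      then show ?thesis by (intro exI[of _ id]) (auto simp: P_def strict_mono_def)
    next
      case False
      define r where "r = enumerate {n. A (s n) \<inter> B i = {}}"
      have "strict_mono r" unfolding r_def using False by (rule strict_mono_enumerate)
      moreover have "A (s (r n)) \<inter> B i = {}" for n
        using enumerate_in_set[OF False, of n] by (simp add: r_def)
      ultimately show ?thesis by (auto simp: P_def)
    qed
  qed
  define r where "r = diagseq"
  have r: "strict_mono r" unfolding r_def by (rule subseq_diagseq)
  have Pr: "P i r" for i
  proof -
    \<comment> \<open>The diagonal sequence is guaranteed to satisfy the \<open>i\<close>-th
      alternative only from index \<open>Suc i\<close> on, which an eventual property does not
      notice.\<close>
    have "P i (diagseq \<circ> ((+) (Suc i)))"
    proof (rule diagseq_holds)
      fix q s :: "nat \<Rightarrow> nat" and n assume "strict_mono q" "P n s"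
      then show "P n (s \<circ> q)"
        unfolding P_def using eventually_subseq[OF \<open>strict_mono q\<close>] by force
    qed
    then have "P i (\<lambda>n. r (n + Suc i))" by (simp only: r_def o_def add.commute[of "Suc i"])
    then show ?thesis
      unfolding P_def
      using eventually_sequentially_seg[of "\<lambda>n. A (r n) \<inter> B i = {}" "Suc i"]
        eventually_sequentially_seg[of "\<lambda>n. A (r n) \<inter> B i \<noteq> {}" "Suc i"] by blast
  qed
  define J where "J = {i. \<forall>\<^sub>F n in sequentially. A (r n) \<inter> B i = {}}"
  \<comment> \<open>\<open>Z\<close> consists of the points all of whose neighbourhoods are met by
    eventually all \<open>A (r n)\<close>; every other point has a neighbourhood that is eventually
    missed.\<close>
  define Z where "Z = - (\<Union>i\<in>J. B i)"
  have "closed Z" unfolding Z_def using opn by auto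
  then have cZ: "compact Z" using cpt by (metis compact_Int_closed inf_top_left)
  have out: "\<exists>U. open U \<and> x \<in> U \<and> (\<forall>\<^sub>F n in sequentially. A (r n) \<inter> U = {})" if "x \<notin> Z" for x
    using that opn by (auto simp: Z_def J_def)
  have meet: "\<forall>\<^sub>F n in sequentially. A (r n) \<inter> U \<noteq> {}" if "x \<in> Z" "open U" "x \<in> U" for x U
  proof -
    obtain i where i: "x \<in> B i" "B i \<subseteq> U" using bas \<open>open U\<close> \<open>x \<in> U\<close> by blast
    with \<open>x \<in> Z\<close> have "i \<notin> J" by (auto simp: Z_def)
    then have "\<forall>\<^sub>F n in sequentially. A (r n) \<inter> B i \<noteq> {}" using Pr[of i] by (auto simp: P_def J_def)
    then show ?thesis by eventually_elim (use i in blast)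
  qed
  \<comment> \<open>Compactness upgrades missing a neighbourhood of each point outside
    \<open>Z\<close> to missing a whole compact set disjoint from \<open>Z\<close>.\<close>
  have avoid: "\<forall>\<^sub>F n in sequentially. A (r n) \<inter> K = {}" if "compact K" "K \<inter> Z = {}" for K
  proof -
    have "K \<subseteq> (\<Union>i\<in>J. B i)" using that by (auto simp: Z_def)
    then obtain F where F: "F \<subseteq> J" "finite F" "K \<subseteq> (\<Union>i\<in>F. B i)"
      using compactE_image[OF \<open>compact K\<close>, of J B] opn by metis
    have "\<forall>\<^sub>F n in sequentially. \<forall>i\<in>F. A (r n) \<inter> B i = {}"
      using F by (intro eventually_ball_finite) (auto simp: J_def)
    then show ?thesis by eventually_elim (use F in blast)
  qed
  have "hausdorff_tendsto (A \<circ> r) Z"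
  proof (cases "Z = {}")
    case True
    then show ?thesis using avoid[of UNIV] cpt by (auto simp: hausdorff_tendsto_def)
  next
    case False
    then obtain z where z: "z \<in> Z" by auto
    have ne: "\<forall>\<^sub>F n in sequentially. A (r n) \<noteq> {}"
      using meet[OF z open_UNIV] by (auto elim: eventually_mono)
    have "\<forall>\<^sub>F n in sequentially. dist (hausdorff_dist (A (r n)) Z) 0 < e" if "e > 0" for e
    proof -
      have c1: "compact {x. e/2 \<le> infdist x Z}"
      proof -
        have "closed {x. e/2 \<le> infdist x Z}" by (intro closed_Collect_le continuous_intros)
        then show ?thesis using cpt by (metis compact_Int_closed inf_top_left)
      qed
      have ev1: "\<forall>\<^sub>F n in sequentially. A (r n) \<inter> {x. e/2 \<le> infdist x Z} = {}"
        using \<open>e > 0\<close> by (intro avoid c1) auto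
      \<comment> \<open>A finite net at scale \<open>e/4\<close> reduces the distances from points
        of \<open>Z\<close> to finitely many balls that are eventually met.\<close>
      obtain F where F: "finite F" "F \<subseteq> Z" "Z \<subseteq> (\<Union>x\<in>F. ball x (e/4))"
        using compactE_image[OF cZ, of Z "\<lambda>x. ball x (e/4)"] \<open>e > 0\<close> by force
      have ev2: "\<forall>\<^sub>F n in sequentially. \<forall>x\<in>F. A (r n) \<inter> ball x (e/4) \<noteq> {}"
        using F \<open>e > 0\<close> by (intro eventually_ball_finite ballI meet) auto
      show ?thesis using ne ev1 ev2
      proof eventually_elim
        case (elim n)
        have "(SUP a\<in>A (r n). infdist a Z) \<le> e/2"
          using elim by (intro cSUP_least) force+
        moreover have "(SUP b\<in>Z. infdist b (A (r n))) \<le> e/2"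
        proof (rule cSUP_least)
          fix b assume "b \<in> Z"
          then obtain x where x: "x \<in> F" "dist x b < e/4" using F by auto
          then obtain a where a: "a \<in> A (r n)" "dist x a < e/4" using elim by fastforce
          have "infdist b (A (r n)) \<le> dist b a" using a by (intro infdist_le)
          also have "\<dots> \<le> e/2" using x a dist_triangle2[of b a x] by (simp add: dist_commute)
          finally show "infdist b (A (r n)) \<le> e/2" .
        qed (use False in auto)
        ultimately have "hausdorff_dist (A (r n)) Z \<le> e/2" by (simp add: hausdorff_dist_def)
        then show ?case using \<open>e > 0\<close> hausdorff_dist_nonneg[OF cpt, of "A (r n)" Z] elim by simp
      qed
    qed
    then have "(\<lambda>n. hausdorff_dist (A (r n)) Z) \<longlonglongrightarrow> 0" by (simp add: tendsto_iff)
    then show ?thesis using False ne by (simp add: hausdorff_tendsto_def)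
  qed
  with r cZ out show thesis using that by blast
qed

section \<open>Regularity of finite Borel measures and Borel sets as preimages under injective
  maps\<close>

lemma (in finite_measure) measure_UN_geometric_le:
  assumes A: "\<And>i. A i \<in> sets M" and le: "\<And>i. measure M (A i) \<le> e * (1/2)^Suc i"
  shows "measure M (\<Union>i. A i) \<le> e"
proof -
  have sums: "(\<lambda>i. e * (1/2)^Suc i) sums (e * 1)"
    by (rule sums_mult[OF power_half_series])
  have "summable (\<lambda>i. measure M (A i))"
    by (rule summable_comparison_test'[OF sums_summable[OF sums], of 0]) (simp only: real_norm_def abs_of_nonneg[OF measure_nonneg] le)
  moreover from this have "(\<Sum>i. measure M (A i)) \<le> e * 1"
    unfolding sums_unique[OF sums] by (rule suminf_le[OF le _ sums_summable[OF sums]])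
  ultimately show ?thesis
    using finite_measure_subadditive_countably[of A] A by force
qed

text \<open>The sets that can be approximated in this way form a sigma-algebra. It contains the
  closed sets because a non-empty closed set is the decreasing intersection of its open metric
  neighbourhoods.\<close>

lemma closed_open_regular:
  fixes A :: "'a::metric_space set"
  assumes "finite_measure \<mu>" and sets: "sets \<mu> = sets borel" and A: "A \<in> sets borel" and "e > (0::real)"
  obtains C V where "closed C" "open V" "C \<subseteq> A" "A \<subseteq> V" "measure \<mu> (V - C) < e"
proof -
  interpret finite_measure \<mu> by fact
  have space: "space \<mu> = UNIV" using sets_eq_imp_space_eq[OF sets] by simp
  have cl: "C \<in> sets \<mu>" if "closed C" for C using that sets by simp
  have opn: "V \<in> sets \<mu>" if "open V" for V using that sets by simp
  define P where "P A \<longleftrightarrow> (\<forall>e>0. \<exists>C V. closed C \<and> open V \<and> C \<subseteq> A \<and> A \<subseteq> V \<and> measure \<mu> (V - C) < e)"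
    for A :: "'a set"
  have "A \<in> sigma_sets UNIV {S. closed S}" using A by (simp add: borel_eq_closed)
  then have "P A"
  proof induction
    case (Basic A)
    then have "closed A" by simp
    show ?case unfolding P_def
    proof (intro allI impI)
      fix e :: real assume "e > 0"
      show "\<exists>C V. closed C \<and> open V \<and> C \<subseteq> A \<and> A \<subseteq> V \<and> measure \<mu> (V - C) < e"
      \<comment> \<open>The empty set is split off because \<open>infdist x {} = 0\<close> would
        make every \<open>V n\<close> the whole space.\<close>
      proof (cases "A = {}")
        case True
        then show ?thesis using \<open>e > 0\<close> by (intro exI[of _ "{}"]) auto
      next
        case False
        define V where "V n = {x. infdist x A < inverse (real (Suc n))}" for n
        have oV: "open (V n)" for n unfolding V_def by (intro open_Collect_less continuous_intros)
        have AV: "A \<subseteq> V n" for n by (auto simp: V_def)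
        have "(\<Inter>n. V n - A) = {}"
        proof (rule ccontr)
          assume "(\<Inter>n. V n - A) \<noteq> {}"
          then obtain x where x: "x \<notin> A" "\<And>n. infdist x A < inverse (real (Suc n))" by (auto simp: V_def)
          then have "infdist x A > 0"
            using \<open>closed A\<close> False in_closed_iff_infdist_zero infdist_nonneg by (metis less_eq_real_def)
          then obtain n where "inverse (real (Suc n)) < infdist x A" using reals_Archimedean by blast
          then show False using x(2)[of n] by simp
        qed
        moreover have "(\<lambda>n. measure \<mu> (V n - A)) \<longlonglongrightarrow> measure \<mu> (\<Inter>n. V n - A)"
        proof (rule finite_Lim_measure_decseq)
          have "V n - A \<in> sets \<mu>" for n using oV \<open>closed A\<close> by (intro sets.Diff opn cl)
          then show "range (\<lambda>n. V n - A) \<subseteq> sets \<mu>" by blast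
          have "V n \<subseteq> V m" if "m \<le> n" for m n
          proof -
            have "inverse (real (Suc n)) \<le> inverse (real (Suc m))"
              using that by (simp add: le_imp_inverse_le)
            then show ?thesis unfolding V_def by (auto intro: less_le_trans)
          qed
          then show "decseq (\<lambda>n. V n - A)" unfolding decseq_def by (intro allI impI Diff_mono order_refl)
        qed
        ultimately have "(\<lambda>n. measure \<mu> (V n - A)) \<longlonglongrightarrow> 0" by (simp only: measure_empty)
        then have "\<forall>\<^sub>F n in sequentially. measure \<mu> (V n - A) < e"
          using \<open>e > 0\<close> by (rule order_tendstoD)
        then obtain n where "measure \<mu> (V n - A) < e" by (auto simp: eventually_sequentially)
        then show ?thesis using oV AV \<open>closed A\<close> by blast
      qed
    qed
  next
    case Empty
    show ?case unfolding P_def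
      by (intro allI impI exI[of _ "{}"]) auto
  next
    case (Compl A)
    show ?case unfolding P_def
    proof (intro allI impI)
      fix e :: real assume "e > 0"
      then obtain C V where "closed C" "open V" "C \<subseteq> A" "A \<subseteq> V" "measure \<mu> (V - C) < e"
        using Compl.IH unfolding P_def by metis
      moreover have "- C - (- V) = V - C" by auto
      ultimately show "\<exists>C V. closed C \<and> open V \<and> C \<subseteq> UNIV - A \<and> UNIV - A \<subseteq> V \<and> measure \<mu> (V - C) < e"
        by (intro exI[of _ "- V"] exI[of _ "- C"]) (auto simp: open_Compl closed_Compl)
    qed
  next
    case (Union A)
    show ?case unfolding P_def
    proof (intro allI impI)
      fix e :: real assume "e > 0"
      have "\<exists>C V. closed C \<and> open V \<and> C \<subseteq> A i \<and> A i \<subseteq> V \<and> measure \<mu> (V - C) < e/2 * (1/2)^Suc i" for i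
      proof -
        have "0 < e/2 * (1/2)^Suc i" using \<open>e > 0\<close> by simp
        then show ?thesis using Union.IH[of i] unfolding P_def by blast
      qed
      then obtain C V where C: "\<And>i. closed (C i)" "\<And>i. C i \<subseteq> A i"
        and V: "\<And>i. open (V i)" "\<And>i. A i \<subseteq> V i" and m: "\<And>i. measure \<mu> (V i - C i) < e/2 * (1/2)^Suc i"
        by metis
      have ms: "C i \<in> sets \<mu>" "V i \<in> sets \<mu>" for i using C(1) V(1) cl opn by auto
      have ms': "(\<Union>i. C i) - (\<Union>i\<le>n. C i) \<in> sets \<mu>" "V i - C i \<in> sets \<mu>" "(\<Union>i. V i - C i) \<in> sets \<mu>" for n i
      proof -
        show *: "V i - C i \<in> sets \<mu>" for i by (rule sets.Diff) (rule ms)+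
        show "(\<Union>i. V i - C i) \<in> sets \<mu>" by (rule sets.countable_UN) (rule image_subsetI, rule *)
        have "(\<Union>i. C i) \<in> sets \<mu>" by (rule sets.countable_UN) (rule image_subsetI, rule ms)
        moreover have "(\<Union>i\<le>n. C i) \<in> sets \<mu>" by (rule sets.finite_UN) (rule finite_atMost, rule ms)
        ultimately show "(\<Union>i. C i) - (\<Union>i\<le>n. C i) \<in> sets \<mu>" by (rule sets.Diff)
      qed
      \<comment> \<open>A countable union of closed sets need not be closed. The gaps between
        \<open>C i\<close> and \<open>V i\<close> use half of the error; truncating the union of the
        \<open>C i\<close> costs less than the other half.\<close>
      have "(\<lambda>n. measure \<mu> ((\<Union>i. C i) - (\<Union>i\<le>n. C i))) \<longlonglongrightarrow> measure \<mu> (\<Inter>n. (\<Union>i. C i) - (\<Union>i\<le>n. C i))"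
      proof (rule finite_Lim_measure_decseq)
        show "range (\<lambda>n. (\<Union>i. C i) - (\<Union>i\<le>n. C i)) \<subseteq> sets \<mu>" using ms' by blast
        show "decseq (\<lambda>n. (\<Union>i. C i) - (\<Union>i\<le>n. C i))"
          unfolding decseq_def by (intro allI impI Diff_mono UN_mono order_refl) simp
      qed
      moreover have "(\<Inter>n. (\<Union>i. C i) - (\<Union>i\<le>n. C i)) = {}" by auto
      ultimately have "(\<lambda>n. measure \<mu> ((\<Union>i. C i) - (\<Union>i\<le>n. C i))) \<longlonglongrightarrow> 0" by (simp only: measure_empty)
      then have "\<forall>\<^sub>F n in sequentially. measure \<mu> ((\<Union>i. C i) - (\<Union>i\<le>n. C i)) < e/2"
        using \<open>e > 0\<close> by (intro order_tendstoD(2)) auto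
      then obtain n where n: "measure \<mu> ((\<Union>i. C i) - (\<Union>i\<le>n. C i)) < e/2" by (auto simp: eventually_sequentially)
      have *: "measure \<mu> (\<Union>i. V i - C i) \<le> e/2"
        by (rule measure_UN_geometric_le) (rule ms', rule less_imp_le, rule m)
      have "measure \<mu> ((\<Union>i. V i) - (\<Union>i\<le>n. C i)) \<le> measure \<mu> ((\<Union>i. V i - C i) \<union> ((\<Union>i. C i) - (\<Union>i\<le>n. C i)))"
      proof (rule finite_measure_mono)
        show "(\<Union>i. V i) - (\<Union>i\<le>n. C i) \<subseteq> (\<Union>i. V i - C i) \<union> ((\<Union>i. C i) - (\<Union>i\<le>n. C i))" by blast
      qed (intro sets.Un ms')
      also have "\<dots> \<le> measure \<mu> (\<Union>i. V i - C i) + measure \<mu> ((\<Union>i. C i) - (\<Union>i\<le>n. C i))"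
        by (rule measure_Un_le) (rule ms')+
      also have "\<dots> < e" using * n by simp
      finally have "measure \<mu> ((\<Union>i. V i) - (\<Union>i\<le>n. C i)) < e" .
      moreover have "(\<Union>i\<le>n. C i) \<subseteq> (\<Union>i. A i)" "(\<Union>i. A i) \<subseteq> (\<Union>i. V i)"
        using C(2) V(2) by (intro UN_mono; simp)+
      moreover have "closed (\<Union>i\<le>n. C i)" "open (\<Union>i. V i)" using C V by auto
      ultimately show "\<exists>C V. closed C \<and> open V \<and> C \<subseteq> \<Union> (range A) \<and> \<Union> (range A) \<subseteq> V \<and> measure \<mu> (V - C) < e"
        by (intro exI[of _ "\<Union>i\<le>n. C i"] exI[of _ "\<Union>i. V i"] conjI)
    qed
  qed
  then show thesis using that \<open>e > 0\<close> unfolding P_def by blast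
qed

text \<open>The sets \<open>B\<close> admitting such an \<open>S\<close> form a sigma-algebra, so
  closed \<open>B\<close> suffice. By Lusin's theorem \<open>f\<close> is continuous on closed sets
  \<open>K n\<close> whose union has full measure. The images of \<open>B \<inter> K n\<close> are
  then compact and their union \<open>S\<close> is Borel; injectivity ensures that the preimage of
  \<open>S\<close> in \<open>Y\<close> contains no point outside \<open>B\<close>.\<close>

lemma injective_measurable_preimage:
  fixes f :: "'a::metric_space \<Rightarrow> 'b::metric_space"
  assumes "finite_measure \<mu>" and sets: "sets \<mu> = sets borel"
    and cptA: "compact (UNIV :: 'a set)" and cptB: "compact (UNIV :: 'b set)"
    and Y: "Y \<in> sets borel" and null: "measure \<mu> (UNIV - Y) = 0"
    and f: "f \<in> restrict_space \<mu> Y \<rightarrow>\<^sub>M borel" and inj: "inj_on f Y"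
    and B: "B \<in> sets borel"
  obtains S where "S \<in> sets borel" "sym_diff B (Y \<inter> f -` S) \<in> null_sets \<mu>"
proof -
  interpret finite_measure \<mu> by fact
  have space: "space \<mu> = UNIV" using sets_eq_imp_space_eq[OF sets] by simp
  have fS: "Y \<inter> f -` S \<in> sets borel" if "S \<in> sets borel" for S
    using measurable_sets[OF f that] Y sets
    by (simp add: space_restrict_space sets_restrict_space_iff space Int_commute)
  obtain W :: "nat \<Rightarrow> 'b set" where oW: "\<And>i. open (W i)"
    and bas: "\<And>U x. open U \<Longrightarrow> x \<in> U \<Longrightarrow> \<exists>i. x \<in> W i \<and> W i \<subseteq> U"
    using compact_countable_basis[OF cptB] by blast
  \<comment> \<open>Lusin's theorem: the preimage of each basic set \<open>W i\<close> is squeezed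
    between a closed \<open>C i\<close> and an open \<open>V i\<close>. Off the union of the gaps it
    coincides with \<open>V i\<close>, hence is relatively open.\<close>
  have lusin: "\<exists>K. closed K \<and> K \<subseteq> Y \<and> continuous_on K f \<and> measure \<mu> (UNIV - K) < e" if "e > 0" for e
  proof -
    have "\<exists>C V. closed C \<and> open V \<and> C \<subseteq> Y \<inter> f -` W i \<and> Y \<inter> f -` W i \<subseteq> V \<and>
        measure \<mu> (V - C) < e/2 * (1/2)^Suc i" for i
    proof -
      have "0 < e/2 * (1/2)^Suc i" using \<open>e > 0\<close> by simp
      moreover have "Y \<inter> f -` W i \<in> sets borel" using oW by (intro fS) auto
      ultimately show ?thesis using closed_open_regular[OF \<open>finite_measure \<mu>\<close> sets] by metis
    qed
    then obtain C V where C: "\<And>i. closed (C i)" "\<And>i. C i \<subseteq> Y \<inter> f -` W i"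
      and V: "\<And>i. open (V i)" "\<And>i. Y \<inter> f -` W i \<subseteq> V i"
      and m: "\<And>i. measure \<mu> (V i - C i) < e/2 * (1/2)^Suc i"
      by metis
    have ms: "C i \<in> sets \<mu>" "V i \<in> sets \<mu>" "Y \<in> sets \<mu>" for i using C(1) V(1) Y sets by auto
    have ms': "V i - C i \<in> sets \<mu>" "(\<Union>i. V i - C i) \<in> sets \<mu>" for i
    proof -
      show *: "V i - C i \<in> sets \<mu>" for i by (rule sets.Diff) (rule ms)+
      show "(\<Union>i. V i - C i) \<in> sets \<mu>" by (rule sets.countable_UN) (rule image_subsetI, rule *)
    qed
    have bad: "measure \<mu> (\<Union>i. V i - C i) \<le> e/2"
      by (rule measure_UN_geometric_le) (rule ms', rule less_imp_le, rule m)
    have "Y - (\<Union>i. V i - C i) \<in> sets borel" using ms ms' sets by (metis sets.Diff)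
    \<comment> \<open>Regularity is applied a second time, to replace the Borel set that is left by
      a closed subset.\<close>
    then obtain K V' where K: "closed K" "open V'" "K \<subseteq> Y - (\<Union>i. V i - C i)" "Y - (\<Union>i. V i - C i) \<subseteq> V'"
       "measure \<mu> (V' - K) < e/2"
      using closed_open_regular[OF \<open>finite_measure \<mu>\<close> sets, of "Y - (\<Union>i. V i - C i)" "e/2" thesis] \<open>e > 0\<close>
      by auto
    have ms'': "V' - K \<in> sets \<mu>" "UNIV - Y \<in> sets \<mu>"
      using K sets sets.compl_sets[of Y \<mu>] space ms by auto
    have "measure \<mu> (UNIV - K) \<le> measure \<mu> ((UNIV - Y) \<union> (\<Union>i. V i - C i) \<union> (V' - K))"
    proof (rule finite_measure_mono)
      show "UNIV - K \<subseteq> (UNIV - Y) \<union> (\<Union>i. V i - C i) \<union> (V' - K)" using K(4) by blast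
    qed (intro sets.Un ms' ms'')
    also have "\<dots> \<le> measure \<mu> ((UNIV - Y) \<union> (\<Union>i. V i - C i)) + measure \<mu> (V' - K)"
      using ms' ms'' by (intro measure_Un_le sets.Un)
    also have "measure \<mu> ((UNIV - Y) \<union> (\<Union>i. V i - C i)) \<le> measure \<mu> (UNIV - Y) + measure \<mu> (\<Union>i. V i - C i)"
      using ms' ms'' by (intro measure_Un_le)
    finally have "measure \<mu> (UNIV - K) < e" using bad K(5) null by simp
    moreover have "continuous_on K f"
      unfolding continuous_on_topological
    proof (intro ballI allI impI)
      fix x U assume x: "x \<in> K" and U: "open U" "f x \<in> U"
      then obtain i where i: "f x \<in> W i" "W i \<subseteq> U" using bas by blast
      have "x \<in> V i" using V(2)[of i] K(3) x i by blast
      moreover have "f y \<in> U" if "y \<in> K" "y \<in> V i" for y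
        using that K(3) C(2)[of i] i by blast
      ultimately show "\<exists>A. open A \<and> x \<in> A \<and> (\<forall>y\<in>K. y \<in> A \<longrightarrow> f y \<in> U)" using V(1) by blast
    qed
    ultimately show ?thesis using K by blast
  qed
  define \<D> where "\<D> = {B \<in> sets borel. \<exists>S\<in>sets borel. sym_diff B (Y \<inter> f -` S) \<in> null_sets \<mu>}"
  have nullY: "UNIV - Y \<in> null_sets \<mu>" 
    using null Y sets space sets.compl_sets[of Y \<mu>] by (auto simp: null_sets_def emeasure_eq_measure)
  have Dun: "(\<Union>i. B i) \<in> \<D>" if B: "\<And>i::nat. B i \<in> \<D>" for B
  proof -
    have "\<forall>i. \<exists>S\<in>sets borel. sym_diff (B i) (Y \<inter> f -` S) \<in> null_sets \<mu>" using B by (auto simp: \<D>_def)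
    then obtain S where S: "\<And>i. S i \<in> sets borel" "\<And>i. sym_diff (B i) (Y \<inter> f -` S i) \<in> null_sets \<mu>"
      by metis
    have n: "(\<Union>i. sym_diff (B i) (Y \<inter> f -` S i)) \<in> null_sets \<mu>" using S(2) by (intro null_sets_UN) 
    have "sym_diff (\<Union>i. B i) (Y \<inter> f -` (\<Union>i. S i)) \<in> null_sets \<mu>"
    proof (rule null_sets_subset[OF n])
      show "sym_diff (\<Union>i. B i) (Y \<inter> f -` (\<Union>i. S i)) \<in> sets \<mu>"
        unfolding sets using B S by (intro sets.Un sets.Diff fS sets.countable_UN) (auto simp: \<D>_def)
    qed auto
    then show ?thesis using B S by (auto simp: \<D>_def intro!: bexI[of _ "\<Union>i. S i"])
  qed
  have Dcl: "B \<in> \<D>" if "closed B" for B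
  proof -
    have "\<exists>K. closed K \<and> K \<subseteq> Y \<and> continuous_on K f \<and> measure \<mu> (UNIV - K) < inverse (real (Suc n))" for n
      by (rule lusin) simp
    then obtain K where K: "\<And>n. closed (K n)" "\<And>n. K n \<subseteq> Y" "\<And>n. continuous_on (K n) f"
      "\<And>n. measure \<mu> (UNIV - K n) < inverse (real (Suc n))" by metis
    have mK: "UNIV - (\<Union>n. K n) \<in> sets \<mu>" unfolding sets using K(1) by (intro sets.Diff sets.countable_UN) auto
    have "measure \<mu> (UNIV - (\<Union>n. K n)) < inverse (real (Suc n))" for n
    proof -
      have "UNIV - K n \<in> sets \<mu>" using K(1)[of n] sets by auto
      then have "measure \<mu> (UNIV - (\<Union>n. K n)) \<le> measure \<mu> (UNIV - K n)"
        by (intro finite_measure_mono) auto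
      then show ?thesis using K(4)[of n] by simp
    qed
    then have "measure \<mu> (UNIV - (\<Union>n. K n)) = 0"
      using reals_Archimedean[of "measure \<mu> (UNIV - (\<Union>n. K n))"] by (meson less_asym measure_nonneg not_less_iff_gr_or_eq zero_less_measure_iff)
    then have nK: "UNIV - (\<Union>n. K n) \<in> null_sets \<mu>" using mK by (auto simp: null_sets_def emeasure_eq_measure)
    define S where "S = (\<Union>n. f ` (B \<inter> K n))"
    have "compact (B \<inter> K n)" for n using that K(1) cptA by (metis closed_Int compact_Int_closed inf_top_left)
    then have "compact (f ` (B \<inter> K n))" for n
      using K(3)[of n] by (intro compact_continuous_image) (auto intro: continuous_on_subset)
    then have S: "S \<in> sets borel" unfolding S_def by (intro sets.countable_UN) (auto intro: borel_compact)
    have "sym_diff B (Y \<inter> f -` S) \<subseteq> UNIV - (\<Union>n. K n)"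
    proof -
      have "x \<in> B" if "x \<in> Y" "f x \<in> S" for x
      proof -
        obtain n y where "f x = f y" "y \<in> B" "y \<in> K n" using \<open>f x \<in> S\<close> by (auto simp: S_def)
        then show "x \<in> B" using inj_onD[OF inj, of x y] K(2)[of n] \<open>x \<in> Y\<close> by auto
      qed
      then show ?thesis using K(2) by (auto simp: S_def)
    qed
    moreover have "sym_diff B (Y \<inter> f -` S) \<in> sets \<mu>"
      unfolding sets using that S by (intro sets.Un sets.Diff fS) auto
    ultimately have "sym_diff B (Y \<inter> f -` S) \<in> null_sets \<mu>" using nK null_sets_subset by blast
    then show ?thesis using that S by (auto simp: \<D>_def)
  qed
  have "B \<in> sigma_sets UNIV {S. closed S}" using B by (simp add: borel_eq_closed)
  then have "B \<in> \<D>"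
  proof induction
    case (Basic A)
    then show ?case using Dcl by simp
  next
    case Empty
    show ?case by (rule Dcl) simp
  next
    case (Compl A)
    then obtain S where S: "A \<in> sets borel" "S \<in> sets borel" "sym_diff A (Y \<inter> f -` S) \<in> null_sets \<mu>"
      by (auto simp: \<D>_def)
    have m: "UNIV - A \<in> sets borel" "UNIV - S \<in> sets borel" using S by (metis borel_comp Compl_eq_Diff_UNIV)+
    have "sym_diff (UNIV - A) (Y \<inter> f -` (UNIV - S)) \<in> null_sets \<mu>"
    proof (rule null_sets_subset[OF null_sets.Un[OF S(3) nullY]])
      show "sym_diff (UNIV - A) (Y \<inter> f -` (UNIV - S)) \<in> sets \<mu>"
        unfolding sets by (rule sets.Un[OF sets.Diff[OF m(1) fS[OF m(2)]] sets.Diff[OF fS[OF m(2)] m(1)]])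
    qed auto
    then show ?case using m by (auto simp: \<D>_def)
  next
    case (Union a)
    then show ?case using Dun[of a] by simp
  qed
  then show thesis using that by (auto simp: \<D>_def)
qed

section \<open>Patterson--Sullivan systems\<close>

context PS_system
begin

section \<open>The action of the group on the measure space\<close>

lemma homeomorphism: assumes "\<gamma> \<in> \<Gamma>" obtains h where "homeomorphism UNIV UNIV \<gamma> h"
  using subgroup.subset[OF subgroup] assms by (auto simp: homeo_group_def)

lemma inv_mem: "\<gamma> \<in> \<Gamma> \<Longrightarrow> inv_into UNIV \<gamma> \<in> \<Gamma>"
  using subgroup.m_inv_closed[OF subgroup] subgroup.subset[OF subgroup] m_inv_homeo_group by (metis subsetD)

lemma comp_mem: "\<alpha> \<in> \<Gamma> \<Longrightarrow> \<beta> \<in> \<Gamma> \<Longrightarrow> \<alpha> \<circ> \<beta> \<in> \<Gamma>"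
  using subgroup.m_closed[OF subgroup, of \<alpha> \<beta>] by (simp add: homeo_group_def)

lemma id_mem: "id \<in> \<Gamma>"
  using subgroup.one_closed[OF subgroup] by (simp add: homeo_group_def)

lemma continuous: "\<gamma> \<in> \<Gamma> \<Longrightarrow> continuous_on UNIV \<gamma>"
  by (metis homeomorphism homeomorphism_def)

lemma bij: "\<gamma> \<in> \<Gamma> \<Longrightarrow> bij \<gamma>"
  by (metis UNIV_I bijI' homeomorphism homeomorphism_apply1 homeomorphism_apply2)

lemma inv_apply [simp]: "\<gamma> \<in> \<Gamma> \<Longrightarrow> inv_into UNIV \<gamma> (\<gamma> x) = x"
  "\<gamma> \<in> \<Gamma> \<Longrightarrow> \<gamma> (inv_into UNIV \<gamma> x) = x"
  using bij[of \<gamma>] by (simp_all add: bij_is_inj bij_is_surj surj_f_inv_f)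

lemma inv_inv [simp]: "\<gamma> \<in> \<Gamma> \<Longrightarrow> inv_into UNIV (inv_into UNIV \<gamma>) = \<gamma>"
  using bij[of \<gamma>] by (simp add: inv_inv_eq)

lemma image_eq_vimage: "\<gamma> \<in> \<Gamma> \<Longrightarrow> \<gamma> ` A = inv_into UNIV \<gamma> -` A"
  using bij[of \<gamma>] by (simp add: bij_vimage_eq_inv_image[OF bij_imp_bij_inv] inv_inv_eq)

lemma measurable: "\<gamma> \<in> \<Gamma> \<Longrightarrow> \<gamma> \<in> borel_measurable borel"
  by (intro borel_measurable_continuous_onI continuous)

lemma vimage_borel: "\<gamma> \<in> \<Gamma> \<Longrightarrow> A \<in> sets borel \<Longrightarrow> \<gamma> -` A \<in> sets borel"
  using measurable_sets[OF measurable] by fastforce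

lemma image_borel: "\<gamma> \<in> \<Gamma> \<Longrightarrow> A \<in> sets borel \<Longrightarrow> \<gamma> ` A \<in> sets borel"
  by (simp add: image_eq_vimage inv_mem vimage_borel)

lemma prob: "prob_space \<mu>" and sets_eq: "sets \<mu> = sets borel" and dim_nonneg: "0 \<le> \<delta>"
  using PS_measure by (auto simp: coarse_PS_measure_def)

sublocale prob_space \<mu> by (rule prob)

lemma space_eq: "space \<mu> = UNIV"
  using sets_eq_imp_space_eq[OF sets_eq] by simp

lemma measurable_\<mu>: "\<gamma> \<in> \<Gamma> \<Longrightarrow> \<gamma> \<in> \<mu> \<rightarrow>\<^sub>M borel"
  using measurable measurable_cong_sets[OF sets_eq refl] by blast

lemma sets_shadow: "\<gamma> \<in> \<Gamma> \<Longrightarrow> R > 0 \<Longrightarrow> shadow R \<gamma> \<in> sets borel"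
  using shadow_open by auto

text \<open>The region where PS2 identifies the cocycle with the magnitude up to a bounded error;
  PS3 and PS5 speak about limits of its complements.\<close>

definition pullback_shadow :: "real \<Rightarrow> ('a \<Rightarrow> 'a) \<Rightarrow> 'a set" where
  "pullback_shadow R \<gamma> = \<gamma> -` shadow R \<gamma>"

lemma open_pullback_shadow: "\<gamma> \<in> \<Gamma> \<Longrightarrow> R > 0 \<Longrightarrow> open (pullback_shadow R \<gamma>)"
  unfolding pullback_shadow_def using shadow_open continuous by (auto intro: open_vimage)

lemma sets_pullback_shadow: "\<gamma> \<in> \<Gamma> \<Longrightarrow> R > 0 \<Longrightarrow> pullback_shadow R \<gamma> \<in> sets borel"
  using open_pullback_shadow by auto

lemma shadow_eq_image: "\<gamma> \<in> \<Gamma> \<Longrightarrow> shadow R \<gamma> = \<gamma> ` pullback_shadow R \<gamma>"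
  unfolding pullback_shadow_def using bij[of \<gamma>] by (simp add: bij_is_surj)

text \<open>Pushing forward by the inverse makes \<open>jac \<gamma>\<close> the density of the
  measure that assigns to \<open>A\<close> the mass of its image under \<open>\<gamma>\<close>, and
  makes it comparable to \<open>exp (- \<delta> * \<sigma> \<gamma> x)\<close> without an inverse in
  the cocycle.\<close>

definition jac :: "('a \<Rightarrow> 'a) \<Rightarrow> 'a \<Rightarrow> ennreal" where
  "jac \<gamma> = RN_deriv \<mu> (distr \<mu> borel (inv_into UNIV \<gamma>))"

lemma jac_measurable [measurable]: "jac \<gamma> \<in> borel_measurable \<mu>"
  by (simp add: jac_def)

lemma absolutely_continuous_distr:
  "\<gamma> \<in> \<Gamma> \<Longrightarrow> absolutely_continuous \<mu> (distr \<mu> borel \<gamma>)"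
  using PS_measure by (auto simp: coarse_PS_measure_def)

lemma density_jac: "\<gamma> \<in> \<Gamma> \<Longrightarrow> density \<mu> (jac \<gamma>) = distr \<mu> borel (inv_into UNIV \<gamma>)"
  unfolding jac_def by (rule density_RN_deriv) (simp_all add: absolutely_continuous_distr inv_mem sets_eq)

lemma nn_integral_inv:
  assumes "\<gamma> \<in> \<Gamma>" and g: "g \<in> borel_measurable borel"
  shows "(\<integral>\<^sup>+x. g (inv_into UNIV \<gamma> x) \<partial>\<mu>) = (\<integral>\<^sup>+x. jac \<gamma> x * g x \<partial>\<mu>)"
proof -
  have g': "g \<in> borel_measurable \<mu>" using g measurable_cong_sets[OF sets_eq refl] by blast
  have "(\<integral>\<^sup>+x. g (inv_into UNIV \<gamma> x) \<partial>\<mu>) = (\<integral>\<^sup>+x. g x \<partial>distr \<mu> borel (inv_into UNIV \<gamma>))"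
    using g by (intro nn_integral_distr[symmetric] measurable_\<mu> inv_mem assms) (simp add: measurable_distr_eq1)
  also have "\<dots> = (\<integral>\<^sup>+x. jac \<gamma> x * g x \<partial>\<mu>)"
    unfolding density_jac[OF assms(1), symmetric] by (intro nn_integral_density jac_measurable g')
  finally show ?thesis .
qed

lemma emeasure_image:
  assumes "\<gamma> \<in> \<Gamma>" "A \<in> sets borel"
  shows "emeasure \<mu> (\<gamma> ` A) = (\<integral>\<^sup>+x. jac \<gamma> x * indicator A x \<partial>\<mu>)"
proof -
  have "emeasure \<mu> (\<gamma> ` A) = (\<integral>\<^sup>+x. indicator (\<gamma> ` A) x \<partial>\<mu>)"
    using image_borel[OF assms] by (simp add: sets_eq)
  also have "\<dots> = (\<integral>\<^sup>+x. indicator A (inv_into UNIV \<gamma> x) \<partial>\<mu>)"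
    by (intro nn_integral_cong) (auto simp: image_eq_vimage[OF assms(1)] indicator_def)
  also have "\<dots> = (\<integral>\<^sup>+x. jac \<gamma> x * indicator A x \<partial>\<mu>)"
    using assms by (intro nn_integral_inv) auto
  finally show ?thesis .
qed

text \<open>Quasi-invariance pulls the exceptional null set back to a null set. Enclosing the
  exceptions in a measurable set first allows arbitrary predicates.\<close>

lemma AE_comp:
  assumes "\<gamma> \<in> \<Gamma>" "AE x in \<mu>. P x"
  shows "AE x in \<mu>. P (\<gamma> x)"
proof -
  obtain N where N: "{x \<in> space \<mu>. \<not> P x} \<subseteq> N" "emeasure \<mu> N = 0" "N \<in> sets \<mu>"
    using AE_E[OF assms(2)] by blast
  then have "N \<in> null_sets (distr \<mu> borel \<gamma>)"
    using absolutely_continuous_distr[OF assms(1)] by (auto simp: absolutely_continuous_def)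
  then have "\<gamma> -` N \<in> null_sets \<mu>"
    using measurable_\<mu>[OF assms(1)] by (simp add: null_sets_distr_iff space_eq)
  then show ?thesis by (rule AE_I') (use N space_eq in auto)
qed

lemma AE_comp_finite:
  assumes "finite F" "F \<subseteq> \<Gamma>" "AE x in \<mu>. P x"
  shows "AE x in \<mu>. \<forall>g\<in>F. P (g x)"
  using assms(2) by (intro AE_finite_allI[OF assms(1)] AE_comp[OF _ assms(3)]) auto

lemma jac_bounds:
  obtains C where "C \<ge> 1"
    "\<And>\<gamma>. \<gamma> \<in> \<Gamma> \<Longrightarrow> AE x in \<mu>. ennreal (inverse C * exp (- \<delta> * \<sigma> \<gamma> x)) \<le> jac \<gamma> x \<and>
        jac \<gamma> x \<le> ennreal (C * exp (- \<delta> * \<sigma> \<gamma> x))"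
proof -
  obtain C where "C \<ge> 1" and C: "\<And>\<gamma>. \<gamma> \<in> \<Gamma> \<Longrightarrow> AE x in \<mu>.
           ennreal (inverse C * exp (- \<delta> * \<sigma> (inv_into UNIV \<gamma>) x))
             \<le> RN_deriv \<mu> (distr \<mu> borel \<gamma>) x \<and>
           RN_deriv \<mu> (distr \<mu> borel \<gamma>) x
             \<le> ennreal (C * exp (- \<delta> * \<sigma> (inv_into UNIV \<gamma>) x))"
    using PS_measure unfolding coarse_PS_measure_def by blast
  show thesis
  proof (rule that[OF \<open>C \<ge> 1\<close>])
    fix \<gamma> assume "\<gamma> \<in> \<Gamma>"
    then show "AE x in \<mu>. ennreal (inverse C * exp (- \<delta> * \<sigma> \<gamma> x)) \<le> jac \<gamma> x \<and>
        jac \<gamma> x \<le> ennreal (C * exp (- \<delta> * \<sigma> \<gamma> x))"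
      using C[OF inv_mem] by (simp add: jac_def)
  qed
qed

text \<open>Integrate the bounds on \<open>jac\<close> over \<open>A\<close>: as
  \<open>\<delta>\<close> is non-negative, a one-sided bound on the cocycle gives a one-sided bound
  on the Jacobian.\<close>

lemma measure_image_bounds:
  obtains C where "C \<ge> 1"
    "\<And>\<gamma> A t. \<gamma> \<in> \<Gamma> \<Longrightarrow> A \<in> sets borel \<Longrightarrow> AE x in \<mu>. x \<in> A \<longrightarrow> t \<le> \<sigma> \<gamma> x \<Longrightarrow>
        prob (\<gamma> ` A) \<le> C * exp (- \<delta> * t) * prob A"
    "\<And>\<gamma> A t. \<gamma> \<in> \<Gamma> \<Longrightarrow> A \<in> sets borel \<Longrightarrow> AE x in \<mu>. x \<in> A \<longrightarrow> \<sigma> \<gamma> x \<le> t \<Longrightarrow>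
        prob A \<le> C * exp (\<delta> * t) * prob (\<gamma> ` A)"
proof -
  obtain C where C1: "C \<ge> 1" and C: "\<And>\<gamma>. \<gamma> \<in> \<Gamma> \<Longrightarrow> AE x in \<mu>.
        ennreal (inverse C * exp (- \<delta> * \<sigma> \<gamma> x)) \<le> jac \<gamma> x \<and>
        jac \<gamma> x \<le> ennreal (C * exp (- \<delta> * \<sigma> \<gamma> x))"
    by (rule jac_bounds) blast
  show thesis
  proof (rule that[OF C1])
    fix \<gamma> A t assume \<gamma>: "\<gamma> \<in> \<Gamma>" and A: "A \<in> sets borel"
      and t: "AE x in \<mu>. x \<in> A \<longrightarrow> t \<le> \<sigma> \<gamma> x"
    have "emeasure \<mu> (\<gamma> ` A) \<le> (\<integral>\<^sup>+x. ennreal (C * exp (- \<delta> * t)) * indicator A x \<partial>\<mu>)"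
      unfolding emeasure_image[OF \<gamma> A]
    proof (rule nn_integral_mono_AE)
      show "AE x in \<mu>. jac \<gamma> x * indicator A x \<le> ennreal (C * exp (- \<delta> * t)) * indicator A x"
        using t C[OF \<gamma>]
      proof eventually_elim
        case (elim x)
        show ?case
        proof (cases "x \<in> A")
          case True
          then have "C * exp (- \<delta> * \<sigma> \<gamma> x) \<le> C * exp (- \<delta> * t)"
            using elim dim_nonneg C1 by (auto intro!: mult_left_mono)
          then show ?thesis using True elim order_trans[OF _ ennreal_leI] by auto
        qed auto
      qed
    qed
    also have "\<dots> = ennreal (C * exp (- \<delta> * t)) * emeasure \<mu> A"
      using A sets_eq by (simp add: nn_integral_cmult_indicator)
    finally have "ennreal (prob (\<gamma> ` A)) \<le> ennreal (C * exp (- \<delta> * t) * prob A)"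
      using C1 by (simp add: emeasure_eq_measure ennreal_mult)
    then show "prob (\<gamma> ` A) \<le> C * exp (- \<delta> * t) * prob A"
      using C1 by (simp add: ennreal_le_iff)
  next
    fix \<gamma> A t assume \<gamma>: "\<gamma> \<in> \<Gamma>" and A: "A \<in> sets borel"
      and t: "AE x in \<mu>. x \<in> A \<longrightarrow> \<sigma> \<gamma> x \<le> t"
    have "ennreal (inverse C * exp (- \<delta> * t)) * emeasure \<mu> A
        = (\<integral>\<^sup>+x. ennreal (inverse C * exp (- \<delta> * t)) * indicator A x \<partial>\<mu>)"
      using A sets_eq by (simp add: nn_integral_cmult_indicator)
    also have "\<dots> \<le> emeasure \<mu> (\<gamma> ` A)"
      unfolding emeasure_image[OF \<gamma> A]
    proof (rule nn_integral_mono_AE)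
      show "AE x in \<mu>. ennreal (inverse C * exp (- \<delta> * t)) * indicator A x \<le> jac \<gamma> x * indicator A x"
        using t C[OF \<gamma>]
      proof eventually_elim
        case (elim x)
        show ?case
        proof (cases "x \<in> A")
          case True
          then have "inverse C * exp (- \<delta> * t) \<le> inverse C * exp (- \<delta> * \<sigma> \<gamma> x)"
            using elim dim_nonneg C1 by (auto intro!: mult_left_mono)
          then show ?thesis using True elim order_trans[OF ennreal_leI] by auto
        qed auto
      qed
    qed
    finally have "ennreal (inverse C * exp (- \<delta> * t) * prob A) \<le> ennreal (prob (\<gamma> ` A))"
      using C1 by (simp add: emeasure_eq_measure ennreal_mult)
    then have "inverse C * exp (- \<delta> * t) * prob A \<le> prob (\<gamma> ` A)"
      by (simp add: ennreal_le_iff)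
    then have "C * exp (\<delta> * t) * (inverse C * exp (- \<delta> * t) * prob A) \<le> C * exp (\<delta> * t) * prob (\<gamma> ` A)"
      using C1 by (intro mult_left_mono) auto
    moreover have "C * exp (\<delta> * t) * (inverse C * exp (- \<delta> * t) * prob A) = prob A"
      using C1 by (simp add: exp_minus field_simps)
    ultimately show "prob A \<le> C * exp (\<delta> * t) * prob (\<gamma> ` A)" by (simp only:)
  qed
qed

text \<open>By PS1 the cocycle of the inverse is essentially bounded, hence so is its Jacobian: a
  fixed group element keeps small sets small.\<close>

lemma measure_vimage_le:
  assumes "g \<in> \<Gamma>"
  obtains K where "K > 0" "\<And>A. A \<in> sets borel \<Longrightarrow> prob (g -` A) \<le> K * prob A"
proof -
  obtain c where c: "c > 0" "AE x in \<mu>. \<bar>\<sigma> (inv_into UNIV g) x\<bar> \<le> c" using PS1[OF inv_mem[OF assms]] by blast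
  obtain C where C1: "C \<ge> 1" and C: "\<And>\<gamma> A t. \<gamma> \<in> \<Gamma> \<Longrightarrow> A \<in> sets borel \<Longrightarrow> AE x in \<mu>. x \<in> A \<longrightarrow> t \<le> \<sigma> \<gamma> x \<Longrightarrow>
        prob (\<gamma> ` A) \<le> C * exp (- \<delta> * t) * prob A"
    by (rule measure_image_bounds) blast
  show thesis
  proof (rule that)
    show "C * exp (- \<delta> * - c) > 0" using C1 by simp
    fix A :: "'a set" assume "A \<in> sets borel"
    moreover have "g -` A = inv_into UNIV g ` A" using image_eq_vimage[OF inv_mem[OF assms]] assms by simp
    moreover have "AE x in \<mu>. x \<in> A \<longrightarrow> - c \<le> \<sigma> (inv_into UNIV g) x"
      using c(2) by eventually_elim auto
    ultimately show "prob (g -` A) \<le> C * exp (- \<delta> * - c) * prob A"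
      using C[OF inv_mem[OF assms], of A "- c"] by simp
  qed
qed

text \<open>PS2 replaces the cocycle by the magnitude up to an error \<open>D\<close>, which enters
  the constant as the factor \<open>exp (\<delta> * D)\<close>.\<close>

lemma shadow_bounds:
  assumes "R > 0"
  obtains K where "K \<ge> 1"
    "\<And>\<gamma> A. \<gamma> \<in> \<Gamma> \<Longrightarrow> A \<in> sets borel \<Longrightarrow> A \<subseteq> pullback_shadow R \<gamma> \<Longrightarrow>
        prob (\<gamma> ` A) \<le> K * exp (- \<delta> * mag \<gamma>) * prob A"
    "\<And>\<gamma> A. \<gamma> \<in> \<Gamma> \<Longrightarrow> A \<in> sets borel \<Longrightarrow> A \<subseteq> pullback_shadow R \<gamma> \<Longrightarrow>
        prob A \<le> K * exp (\<delta> * mag \<gamma>) * prob (\<gamma> ` A)"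
proof -
  obtain D where D: "D > 0" "\<And>\<gamma>. \<gamma> \<in> \<Gamma> \<Longrightarrow> AE x in \<mu>. x \<in> pullback_shadow R \<gamma> \<longrightarrow>
        mag \<gamma> - D \<le> \<sigma> \<gamma> x \<and> \<sigma> \<gamma> x \<le> mag \<gamma> + D"
    using PS2[OF assms] unfolding pullback_shadow_def by blast
  obtain C where C1: "C \<ge> 1" and C: "\<And>\<gamma> A t. \<gamma> \<in> \<Gamma> \<Longrightarrow> A \<in> sets borel \<Longrightarrow> AE x in \<mu>. x \<in> A \<longrightarrow> t \<le> \<sigma> \<gamma> x \<Longrightarrow>
        prob (\<gamma> ` A) \<le> C * exp (- \<delta> * t) * prob A"
    "\<And>\<gamma> A t. \<gamma> \<in> \<Gamma> \<Longrightarrow> A \<in> sets borel \<Longrightarrow> AE x in \<mu>. x \<in> A \<longrightarrow> \<sigma> \<gamma> x \<le> t \<Longrightarrow>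
        prob A \<le> C * exp (\<delta> * t) * prob (\<gamma> ` A)"
    by (rule measure_image_bounds) blast
  show thesis
  proof (rule that)
    have "0 \<le> \<delta> * D" using D dim_nonneg by simp
    then have "1 * 1 \<le> C * exp (\<delta> * D)" using C1 by (intro mult_mono) auto
    then show "1 \<le> C * exp (\<delta> * D)" by simp
    fix \<gamma> A assume A: "\<gamma> \<in> \<Gamma>" "A \<in> sets borel" "A \<subseteq> pullback_shadow R \<gamma>"
    have "AE x in \<mu>. x \<in> A \<longrightarrow> mag \<gamma> - D \<le> \<sigma> \<gamma> x"
      using D(2)[OF A(1)] by eventually_elim (use A(3) in auto)
    from C(1)[OF A(1,2) this] show "prob (\<gamma> ` A) \<le> C * exp (\<delta> * D) * exp (- \<delta> * mag \<gamma>) * prob A"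
      by (simp add: algebra_simps flip: exp_add)
    have "AE x in \<mu>. x \<in> A \<longrightarrow> \<sigma> \<gamma> x \<le> mag \<gamma> + D"
      using D(2)[OF A(1)] by eventually_elim (use A(3) in auto)
    from C(2)[OF A(1,2) this] show "prob A \<le> C * exp (\<delta> * D) * exp (\<delta> * mag \<gamma>) * prob (\<gamma> ` A)"
      by (simp add: algebra_simps flip: exp_add)
  qed
qed

end

section \<open>Common covers by pulled-back shadows\<close>

text \<open>Collects hypotheses (a) to (c) apart from the measure of the conical limit set; that one
  and non-singularity are assumed only where they are used.\<close>

locale PS_pair =
  P1: well_behaved_PS_system \<Gamma>\<^sub>1 \<sigma>\<^sub>1 \<mu>\<^sub>1 \<delta>\<^sub>1 mag\<^sub>1 shadow\<^sub>1 H\<^sub>1 +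
  P2: PS_system \<Gamma>\<^sub>2 \<sigma>\<^sub>2 \<mu>\<^sub>2 \<delta>\<^sub>2 mag\<^sub>2 shadow\<^sub>2
  for \<Gamma>\<^sub>1 :: "('a::metric_space \<Rightarrow> 'a) set" and \<sigma>\<^sub>1 \<mu>\<^sub>1 \<delta>\<^sub>1 mag\<^sub>1 shadow\<^sub>1 H\<^sub>1
    and \<Gamma>\<^sub>2 :: "('b::metric_space \<Rightarrow> 'b) set" and \<sigma>\<^sub>2 \<mu>\<^sub>2 \<delta>\<^sub>2 mag\<^sub>2 shadow\<^sub>2 +
  fixes \<rho> :: "('a \<Rightarrow> 'a) \<Rightarrow> ('b \<Rightarrow> 'b)" and Y :: "'a set" and f :: "'a \<Rightarrow> 'b"
  assumes epi: "\<rho> \<in> epi (homeo_group\<lparr>carrier := \<Gamma>\<^sub>1\<rparr>) (homeo_group\<lparr>carrier := \<Gamma>\<^sub>2\<rparr>)"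
    and injection: "ae_equivariant_injection \<Gamma>\<^sub>1 \<mu>\<^sub>1 \<rho> Y f"
begin

lemma \<rho>_mem: "g \<in> \<Gamma>\<^sub>1 \<Longrightarrow> \<rho> g \<in> \<Gamma>\<^sub>2"
  using epi by (auto simp: epi_def hom_def)

lemma \<rho>_comp: "g \<in> \<Gamma>\<^sub>1 \<Longrightarrow> h \<in> \<Gamma>\<^sub>1 \<Longrightarrow> \<rho> (g \<circ> h) = \<rho> g \<circ> \<rho> h"
  using epi by (auto simp: epi_def hom_def homeo_group_def)

lemma \<rho>_surj: "h \<in> \<Gamma>\<^sub>2 \<Longrightarrow> \<exists>g\<in>\<Gamma>\<^sub>1. \<rho> g = h"
  using epi by (auto simp: epi_def)

lemma Y_borel: "Y \<in> sets borel" and Y_full: "AE x in \<mu>\<^sub>1. x \<in> Y"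
  and f_measurable: "f \<in> restrict_space \<mu>\<^sub>1 Y \<rightarrow>\<^sub>M borel" and f_inj: "inj_on f Y"
  and f_equivariant: "g \<in> \<Gamma>\<^sub>1 \<Longrightarrow> y \<in> Y \<Longrightarrow> f (g y) = \<rho> g (f y)"
  and Y_invariant: "g \<in> \<Gamma>\<^sub>1 \<Longrightarrow> g ` Y = Y"
  using injection P1.sets_eq P1.AE_in_set_eq_1[of Y] by (auto simp: ae_equivariant_injection_def)

lemma Y_mem_iff: "g \<in> \<Gamma>\<^sub>1 \<Longrightarrow> g y \<in> Y \<longleftrightarrow> y \<in> Y"
  using Y_invariant[of g] P1.bij[of g] by (metis bij_is_inj inj_image_mem_iff)

text \<open>Along a sequence of counterexamples the complements of the pulled-back shadows converge to
  \<open>Z\<^sub>1\<close> and \<open>Z\<^sub>2\<close>; finitely many elements move any point off \<open>Z\<^sub>2\<close> (PS3), and PS5 takes a point off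
  the corresponding translates of \<open>Z\<^sub>1\<close> at once.\<close>

lemma common_pullback_cover:
  obtains R\<^sub>0 F where "R\<^sub>0 > 0" "finite F" "F \<subseteq> \<Gamma>\<^sub>1"
    "\<And>R \<gamma> y. R \<ge> R\<^sub>0 \<Longrightarrow> \<gamma> \<in> \<Gamma>\<^sub>1 \<Longrightarrow> y \<in> Y \<Longrightarrow>
      \<exists>g\<in>F. g y \<in> P1.pullback_shadow R \<gamma> \<and> f (g y) \<in> P2.pullback_shadow R (\<rho> \<gamma>)"
proof (rule ccontr)
  assume neg: "\<not> thesis"
  define e where "e = from_nat_into \<Gamma>\<^sub>1"
  have e: "range e = \<Gamma>\<^sub>1"
    unfolding e_def using P1.PS4_countable P1.id_mem by (intro range_from_nat_into) auto
  \<comment> \<open>At stage \<open>n\<close> the finite set consists of the first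
    \<open>Suc n\<close> terms of the enumeration, so every fixed group element is tested from some
    stage on.\<close>
  have "\<exists>R \<gamma> y. R \<ge> real (Suc n) \<and> \<gamma> \<in> \<Gamma>\<^sub>1 \<and> y \<in> Y \<and>
      (\<forall>g\<in>e ` {..n}. \<not> (g y \<in> P1.pullback_shadow R \<gamma> \<and> f (g y) \<in> P2.pullback_shadow R (\<rho> \<gamma>)))" for n
  proof (rule ccontr)
    assume "\<not> ?thesis"
    then show False using neg that[of "real (Suc n)" "e ` {..n}"] e by fastforce
  qed
  then obtain R \<gamma> y where R: "\<And>n. R n \<ge> real (Suc n)" and \<gamma>: "\<And>n. \<gamma> n \<in> \<Gamma>\<^sub>1" and y: "\<And>n. y n \<in> Y"
    and bad: "\<And>n g. g \<in> e ` {..n} \<Longrightarrow>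
      \<not> (g (y n) \<in> P1.pullback_shadow (R n) (\<gamma> n) \<and> f (g (y n)) \<in> P2.pullback_shadow (R n) (\<rho> (\<gamma> n)))"
    by metis
  \<comment> \<open>Successive subsequences make \<open>y n\<close>, \<open>f (y n)\<close> and both
    sequences of complements converge. Since \<open>f\<close> need not be continuous, no relation
    between the limits \<open>x\<close> and \<open>w\<close> is available.\<close>
  obtain x r1 where r1: "strict_mono (r1 :: nat \<Rightarrow> nat)" "(y \<circ> r1) \<longlonglongrightarrow> x"
    using P1.compact_space compact_imp_seq_compact seq_compactE[of UNIV y] by (metis UNIV_I)
  obtain w r2 where r2: "strict_mono (r2 :: nat \<Rightarrow> nat)" "(f \<circ> y \<circ> r1 \<circ> r2) \<longlonglongrightarrow> w"
    using P2.compact_space compact_imp_seq_compact seq_compactE[of UNIV "f \<circ> y \<circ> r1"] by (metis UNIV_I)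
  define A1 where "A1 n = UNIV - P1.pullback_shadow (R n) (\<gamma> n)" for n
  define A2 where "A2 n = UNIV - P2.pullback_shadow (R n) (\<rho> (\<gamma> n))" for n
  obtain r3 Z\<^sub>1 where r3: "strict_mono (r3 :: nat \<Rightarrow> nat)" and Z1: "compact Z\<^sub>1"
      "hausdorff_tendsto (A1 \<circ> r1 \<circ> r2 \<circ> r3) Z\<^sub>1"
      "\<And>x. x \<notin> Z\<^sub>1 \<Longrightarrow> \<exists>U. open U \<and> x \<in> U \<and> (\<forall>\<^sub>F n in sequentially. (A1 \<circ> r1 \<circ> r2) (r3 n) \<inter> U = {})"
    by (rule hausdorff_subsequence[OF P1.compact_space, of "A1 \<circ> r1 \<circ> r2"]) blast
  obtain r4 Z\<^sub>2 where r4: "strict_mono (r4 :: nat \<Rightarrow> nat)" and Z2: "compact Z\<^sub>2"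
      "hausdorff_tendsto (A2 \<circ> r1 \<circ> r2 \<circ> r3 \<circ> r4) Z\<^sub>2"
      "\<And>x. x \<notin> Z\<^sub>2 \<Longrightarrow> \<exists>U. open U \<and> x \<in> U \<and> (\<forall>\<^sub>F n in sequentially. (A2 \<circ> r1 \<circ> r2 \<circ> r3) (r4 n) \<inter> U = {})"
    by (rule hausdorff_subsequence[OF P2.compact_space, of "A2 \<circ> r1 \<circ> r2 \<circ> r3"]) blast
  define r where "r = r1 \<circ> r2 \<circ> r3 \<circ> r4"
  have r: "strict_mono r" unfolding r_def using r1 r2 r3 r4 by (intro strict_mono_o)
  have near1: "\<exists>U. open U \<and> x \<in> U \<and> (\<forall>\<^sub>F n in sequentially. A1 (r n) \<inter> U = {})" if "x \<notin> Z\<^sub>1" for x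
    using Z1(3)[OF that] eventually_subseq[OF r4] unfolding r_def o_def by blast
  have near2: "\<exists>U. open U \<and> x \<in> U \<and> (\<forall>\<^sub>F n in sequentially. A2 (r n) \<inter> U = {})" if "x \<notin> Z\<^sub>2" for x
    using Z2(3)[OF that] unfolding r_def o_def by blast
  have lim_y: "(\<lambda>n. y (r n)) \<longlonglongrightarrow> x"
    using LIMSEQ_subseq_LIMSEQ[OF r1(2) strict_mono_o[OF strict_mono_o[OF r2(1) r3] r4]]
    by (simp add: r_def o_def)
  have lim_f: "(\<lambda>n. f (y (r n))) \<longlonglongrightarrow> w"
    using LIMSEQ_subseq_LIMSEQ[OF r2(2) strict_mono_o[OF r3 r4]]
    by (simp add: r_def o_def)
  have Rpos: "R n > 0" for n using R[of n] by linarith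
  have "R (r n) \<ge> real n" for n
    using R[of "r n"] seq_suble[OF r, of n] by linarith
  then have R_top: "filterlim (\<lambda>n. R (r n)) at_top sequentially"
    by (intro filterlim_at_top_mono[OF filterlim_real_sequentially]) auto
  have tend1: "shadow_complements_tendsto \<Gamma>\<^sub>1 shadow\<^sub>1 (\<lambda>n. \<gamma> (r n)) (\<lambda>n. R (r n)) Z\<^sub>1"
    using hausdorff_tendsto_subseq[OF Z1(2) r4] Z1(1) R_top Rpos \<gamma>
    by (simp add: shadow_complements_tendsto_def r_def A1_def o_def P1.pullback_shadow_def)
  have tend2: "shadow_complements_tendsto \<Gamma>\<^sub>2 shadow\<^sub>2 (\<lambda>n. \<rho> (\<gamma> (r n))) (\<lambda>n. R (r n)) Z\<^sub>2"
    using Z2(1,2) R_top Rpos \<gamma> \<rho>_mem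
    by (simp add: shadow_complements_tendsto_def r_def A2_def o_def P2.pullback_shadow_def)
  have oZ: "open (- Z\<^sub>2)" using Z2(1) by (simp add: compact_imp_closed open_Compl)
  \<comment> \<open>PS3 applies to points of \<open>Z\<^sub>2\<close>; at the others the identity
    serves. Compactness then leaves a finite set \<open>K\<close> of elements to try.\<close>
  have "\<exists>h\<in>\<Gamma>\<^sub>1. \<rho> h z \<notin> Z\<^sub>2" for z
  proof (cases "z \<in> Z\<^sub>2")
    case True
    then show ?thesis using P2.PS3[OF tend2] \<rho>_surj by metis
  next
    case False
    then show ?thesis using \<rho>_surj[OF P2.id_mem] by (metis id_apply)
  qed
  then have "UNIV \<subseteq> (\<Union>h\<in>\<Gamma>\<^sub>1. \<rho> h -` (- Z\<^sub>2))" by blast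
  moreover have "open (\<rho> h -` (- Z\<^sub>2))" if "h \<in> \<Gamma>\<^sub>1" for h
    using P2.continuous[OF \<rho>_mem[OF that]] oZ by (rule open_vimage[rotated])
  ultimately obtain K where K: "K \<subseteq> \<Gamma>\<^sub>1" "finite K" "UNIV \<subseteq> (\<Union>h\<in>K. \<rho> h -` (- Z\<^sub>2))"
    using compactE_image[OF P2.compact_space, of \<Gamma>\<^sub>1 "\<lambda>h. \<rho> h -` (- Z\<^sub>2)"] by metis
  \<comment> \<open>One \<open>g\<close> must serve all \<open>h\<close> in \<open>K\<close>,
    because the right \<open>h\<close> is known only after \<open>\<rho> g w\<close> is. PS5 needs a
    point of \<open>Z\<^sub>1\<close>, so it is applied at some \<open>h x\<close> in
    \<open>Z\<^sub>1\<close> with the inverses of \<open>K\<close> as translating elements; if there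
    is no such \<open>h\<close>, the identity works.\<close>
  have "\<exists>g\<in>\<Gamma>\<^sub>1. \<forall>h\<in>K. h (g x) \<notin> Z\<^sub>1"
  proof -
    let ?F = "inv_into UNIV ` K"
    have *: "h (k v) \<notin> Z\<^sub>1" if "k v \<notin> (\<Union>h\<in>?F. h ` Z\<^sub>1)" "h \<in> K" for k :: "'a \<Rightarrow> 'a" and v h
      using that K(1) P1.inv_apply(1)[of h "k v"] by (metis UN_I imageI subsetD)
    have F: "finite ?F" "?F \<subseteq> \<Gamma>\<^sub>1" using K P1.inv_mem by auto
    show ?thesis
    proof (cases "\<exists>h\<in>K. h x \<in> Z\<^sub>1")
      case True
      then obtain h where h: "h \<in> K" "h x \<in> Z\<^sub>1" by blast
      then obtain k where k: "k \<in> \<Gamma>\<^sub>1" "k (h x) \<notin> (\<Union>h\<in>?F. h ` Z\<^sub>1)"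
        using P1.PS5[OF tend1 F] by blast
      then show ?thesis using *[of k "h x"] P1.comp_mem[of k h] h K(1)
        by (intro bexI[of _ "k \<circ> h"]) auto
    next
      case False
      then show ?thesis using P1.id_mem by (intro bexI[of _ id]) auto
    qed
  qed
  then obtain g where g: "g \<in> \<Gamma>\<^sub>1" "\<And>h. h \<in> K \<Longrightarrow> h (g x) \<notin> Z\<^sub>1" by blast
  obtain h where h: "h \<in> K" "\<rho> h (\<rho> g w) \<notin> Z\<^sub>2" using K(3) by blast
  then have h1: "h \<in> \<Gamma>\<^sub>1" using K by auto
  define k where "k = h \<circ> g"
  have k: "k \<in> \<Gamma>\<^sub>1" "k x \<notin> Z\<^sub>1" "\<rho> k w \<notin> Z\<^sub>2"
    using h h1 g P1.comp_mem \<rho>_comp by (auto simp: k_def)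
  obtain U1 where U1: "open U1" "k x \<in> U1" "\<forall>\<^sub>F n in sequentially. A1 (r n) \<inter> U1 = {}"
    using near1[OF k(2)] by blast
  obtain U2 where U2: "open U2" "\<rho> k w \<in> U2" "\<forall>\<^sub>F n in sequentially. A2 (r n) \<inter> U2 = {}"
    using near2[OF k(3)] by blast
  have "(\<lambda>n. k (y (r n))) \<longlonglongrightarrow> k x"
    using continuous_on_tendsto_compose[OF P1.continuous[OF k(1)] lim_y] by simp
  then have ev1: "\<forall>\<^sub>F n in sequentially. k (y (r n)) \<in> U1" using U1 by (metis topological_tendstoD)
  have "(\<lambda>n. \<rho> k (f (y (r n)))) \<longlonglongrightarrow> \<rho> k w"
    using continuous_on_tendsto_compose[OF P2.continuous[OF \<rho>_mem[OF k(1)]] lim_f] by simp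
  then have ev2: "\<forall>\<^sub>F n in sequentially. \<rho> k (f (y (r n))) \<in> U2" using U2 by (metis topological_tendstoD)
  obtain m where m: "k = e m" using k(1) e by blast
  have "\<forall>\<^sub>F n in sequentially. False"
    using ev1 ev2 U1(3) U2(3) eventually_ge_at_top[of m]
  proof eventually_elim
    case (elim n)
    then have "k \<in> e ` {..r n}" using m seq_suble[OF r, of n] by auto
    moreover have "k (y (r n)) \<in> P1.pullback_shadow (R (r n)) (\<gamma> (r n))"
      using elim by (auto simp: A1_def)
    moreover have "f (k (y (r n))) \<in> P2.pullback_shadow (R (r n)) (\<rho> (\<gamma> (r n)))"
      using elim f_equivariant[OF k(1) y] by (auto simp: A2_def)
    ultimately show ?case using bad by blast
  qed
  then show False by simp
qed

end

section \<open>Density of pulled-back sets\<close>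

text \<open>Greedy selection: an element \<open>a\<close> with smallest \<open>m\<close> absorbs
  into \<open>U' a\<close> every set that meets \<open>U a\<close>, and one continues with the rest.
  Later \<open>m\<close> is the magnitude and \<open>U\<close>, \<open>U'\<close> are the shadows of
  radii \<open>R\<close> and \<open>R'\<close> from PS7.\<close>

lemma finite_vitali_cover:
  fixes m :: "'i \<Rightarrow> 'c::linorder" and U U' :: "'i \<Rightarrow> 'b set"
  assumes "finite F"
    and "\<And>a b. a \<in> F \<Longrightarrow> b \<in> F \<Longrightarrow> m a \<le> m b \<Longrightarrow> U a \<inter> U b \<noteq> {} \<Longrightarrow> U b \<subseteq> U' a"
  shows "\<exists>S\<subseteq>F. disjoint_family_on U S \<and> (\<Union>a\<in>F. U a) \<subseteq> (\<Union>a\<in>S. U' a)"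
  using assms
proof (induction F rule: finite_psubset_induct)
  case (psubset F)
  show ?case
  proof (cases "F = {}")
    case True
    then show ?thesis by (auto simp: disjoint_family_on_def)
  next
    case False
    obtain a where a: "a \<in> F" "\<And>b. b \<in> F \<Longrightarrow> m a \<le> m b"
      using ex_min_if_finite[of "m ` F"] False psubset.hyps by (metis arg_min_if_finite(1) arg_min_least)
    \<comment> \<open>Removing \<open>a\<close> explicitly makes \<open>F'\<close> a proper subset
      even when \<open>U a\<close> is empty.\<close>
    define F' where "F' = {b \<in> F. U a \<inter> U b = {}} - {a}"
    have sub: "F' \<subset> F" using a(1) by (auto simp: F'_def)
    have "\<exists>S\<subseteq>F'. disjoint_family_on U S \<and> (\<Union>a\<in>F'. U a) \<subseteq> (\<Union>a\<in>S. U' a)"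
      using psubset.prems sub by (intro psubset.IH) auto
    then obtain S where S: "S \<subseteq> F'" "disjoint_family_on U S" "(\<Union>a\<in>F'. U a) \<subseteq> (\<Union>a\<in>S. U' a)"
      by blast
    have rest: "U b \<subseteq> U' a" if "b \<in> F" "b \<notin> F'" for b
    proof (cases "U b = {}")
      case False
      then have "U a \<inter> U b \<noteq> {}" using that by (auto simp: F'_def)
      then show ?thesis using a that(1) psubset.prems by blast
    qed auto
    show ?thesis
    proof (intro exI[of _ "insert a S"] conjI)
      show "insert a S \<subseteq> F" using S(1) sub a(1) by auto
      show "disjoint_family_on U (insert a S)"
        using S(1,2) unfolding disjoint_family_on_def F'_def by fast
      show "(\<Union>a\<in>F. U a) \<subseteq> (\<Union>a\<in>insert a S. U' a)"
      proof
        fix x assume "x \<in> (\<Union>a\<in>F. U a)"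
        then obtain b where b: "b \<in> F" "x \<in> U b" by blast
        show "x \<in> (\<Union>a\<in>insert a S. U' a)"
        proof (cases "b \<in> F'")
          case True
          then show ?thesis using b S(3) by blast
        next
          case False
          then show ?thesis using rest[OF b(1)] b(2) by blast
        qed
      qed
    qed
  qed
qed

context PS_system
begin

lemma measure_translates_le:
  assumes "finite F" "F \<subseteq> \<Gamma>"
  obtains K where "K > 0" "\<And>A. A \<in> sets borel \<Longrightarrow> prob (\<Union>g\<in>F. g -` A) \<le> K * prob A"
proof -
  have "\<forall>g\<in>F. \<exists>K>0. \<forall>A\<in>sets borel. prob (g -` A) \<le> K * prob A"
    using assms(2) measure_vimage_le by (metis subsetD)
  then obtain K where K: "\<And>g. g \<in> F \<Longrightarrow> K g > 0" "\<And>g A. g \<in> F \<Longrightarrow> A \<in> sets borel \<Longrightarrow> prob (g -` A) \<le> K g * prob A"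
    by metis
  show thesis
  proof (rule that)
    \<comment> \<open>The summand 1 keeps the constant positive when \<open>F\<close> is
      empty.\<close>
    show "1 + sum K F > 0" using K(1) by (smt (verit) sum_nonneg)
    fix A :: "'a set" assume A: "A \<in> sets borel"
    have "prob (\<Union>g\<in>F. g -` A) \<le> (\<Sum>g\<in>F. prob (g -` A))"
      using assms A vimage_borel sets_eq by (intro finite_measure_subadditive_finite) auto
    also have "\<dots> \<le> (\<Sum>g\<in>F. K g * prob A)" using K(2) A by (intro sum_mono)
    also have "\<dots> \<le> (1 + sum K F) * prob A" by (simp add: sum_distrib_right distrib_right)
    finally show "prob (\<Union>g\<in>F. g -` A) \<le> (1 + sum K F) * prob A" .
  qed
qed

end

section \<open>Radial limit points and the Vitali argument\<close>

context well_behaved_PS_system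
begin

text \<open>The conical limit set is the union, over all \<open>R > 0\<close>, of the translates of
  these sets by elements of \<open>\<Gamma>\<close>.\<close>

definition radial_limit_set :: "real \<Rightarrow> 'a set" where
  "radial_limit_set R = {x. \<exists>g. escaping g \<and> (\<forall>n\<ge>1. g n \<in> H (real n) \<and> x \<in> shadow R (g n))}"

lemma H_subset: "R \<ge> 0 \<Longrightarrow> H R \<subseteq> \<Gamma>" and H_antimono: "0 \<le> R \<Longrightarrow> R \<le> S \<Longrightarrow> H S \<subseteq> H R"
  using hierarchy by (auto simp: hierarchy_def)

lemma radial_limit_set_mono:
  assumes "0 < R" "R \<le> S"
  shows "radial_limit_set R \<subseteq> radial_limit_set S"
proof
  fix x assume "x \<in> radial_limit_set R"
  then obtain g where g: "escaping g" "\<And>n. n \<ge> 1 \<Longrightarrow> g n \<in> H (real n) \<and> x \<in> shadow R (g n)"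
    by (auto simp: radial_limit_set_def)
  have "x \<in> shadow S (g n)" if "n \<ge> 1" for n
    using g(2)[OF that] PS6[OF assms, of "g n"] H_antimono[of 0 "real n"] by auto
  then show "x \<in> radial_limit_set S" using g by (auto simp: radial_limit_set_def)
qed

text \<open>By PS8 the shadows along an escaping sequence shrink to the radial point they contain.
  This is the fine cover for the Vitali argument.\<close>

lemma small_shadow:
  assumes "R > 0"
  obtains M' where "AE x in \<mu>. x \<in> M'"
    "\<And>x V. x \<in> M' \<Longrightarrow> x \<in> radial_limit_set R \<Longrightarrow> open V \<Longrightarrow> x \<in> V \<Longrightarrow>
      \<exists>\<gamma>\<in>H R. x \<in> shadow R \<gamma> \<and> shadow R \<gamma> \<subseteq> V"
proof -
  obtain M' where M': "AE x in \<mu>. x \<in> M'"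
    "\<And>g x. (\<And>n. g n \<in> H R) \<Longrightarrow> escaping g \<Longrightarrow> x \<in> M' \<inter> (\<Inter>n. shadow R (g n)) \<Longrightarrow>
        (\<lambda>n. diameter (shadow R (g n))) \<longlonglongrightarrow> 0"
    using PS8[OF assms] by blast
  show thesis
  proof (rule that[OF M'(1)])
    fix x V assume x: "x \<in> M'" "x \<in> radial_limit_set R" and V: "open V" "x \<in> V"
    obtain g where g: "escaping g" "\<And>n. n \<ge> 1 \<Longrightarrow> g n \<in> H (real n) \<and> x \<in> shadow R (g n)"
      using x(2) by (auto simp: radial_limit_set_def)
    \<comment> \<open>Dropping \<open>k\<close> terms skips the index 0 and puts the whole sequence
      into \<open>H R\<close>, as \<open>H (real n)\<close> is contained in \<open>H R\<close> once
      \<open>n\<close> is at least \<open>R\<close>.\<close>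
    define k where "k = Suc (nat \<lceil>R\<rceil>)"
    have k: "R \<le> real (n + k)" for n unfolding k_def by linarith
    define g' where "g' n = g (n + k)" for n
    have g': "g' n \<in> H R" "x \<in> shadow R (g' n)" for n
      using g(2)[of "n + k"] H_antimono[OF _ k[of n]] assms by (auto simp: g'_def k_def)
    have "escaping g'"
      using g(1) eventually_sequentially_seg[of "\<lambda>n. g n \<notin> F" k for F]
      unfolding escaping_def g'_def by blast
    then have "(\<lambda>n. diameter (shadow R (g' n))) \<longlonglongrightarrow> 0"
      using M'(2)[of g' x] g' x(1) by blast
    obtain r where r: "r > 0" "ball x r \<subseteq> V" using V openE by metis
    then have "\<forall>\<^sub>F n in sequentially. diameter (shadow R (g' n)) < r"
      using \<open>(\<lambda>n. diameter (shadow R (g' n))) \<longlonglongrightarrow> 0\<close> by (metis order_tendstoD(2))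
    then obtain n where n: "diameter (shadow R (g' n)) < r" by (auto simp: eventually_sequentially)
    have "bounded (shadow R (g' n))"
      using compact_imp_bounded[OF compact_space] bounded_subset by blast
    then have "z \<in> ball x r" if "z \<in> shadow R (g' n)" for z
      using diameter_bounded_bound[of "shadow R (g' n)" x z] that g'(2)[of n] n by auto
    then show "\<exists>\<gamma>\<in>H R. x \<in> shadow R \<gamma> \<and> shadow R \<gamma> \<subseteq> V"
      using g' r by blast
  qed
qed

text \<open>Replaces the Lebesgue differentiation theorem: if no pulled-back shadow were almost filled by
  the pulled-back set, a Vitali argument would make the radial points of \<open>D\<close> a null set.\<close>

lemma pulled_back_density:
  assumes R: "R > 0" and D: "D \<in> sets borel" and e: "e > 0"
    and nonnull: "\<not> (AE x in \<mu>. \<not> (x \<in> D \<and> x \<in> radial_limit_set R))"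
  obtains \<gamma> where "\<gamma> \<in> \<Gamma>" "prob (pullback_shadow R \<gamma> - \<gamma> -` D) \<le> e"
proof (rule ccontr)
  assume "\<not> thesis"
  with that have neg: "\<And>\<gamma>. \<gamma> \<in> \<Gamma> \<Longrightarrow> e < prob (pullback_shadow R \<gamma> - \<gamma> -` D)" by force
  have HG: "H R \<subseteq> \<Gamma>" using H_subset R by simp
  obtain R' where R': "R' > 0" "\<And>\<alpha> \<beta>. \<alpha> \<in> H R \<Longrightarrow> \<beta> \<in> H R \<Longrightarrow> mag \<alpha> \<le> mag \<beta> \<Longrightarrow>
      shadow R \<alpha> \<inter> shadow R \<beta> \<noteq> {} \<Longrightarrow> shadow R \<beta> \<subseteq> shadow R' \<alpha>"
    using PS7[OF R] by blast
  obtain K where K1: "K \<ge> 1" and K: "\<And>\<gamma> A. \<gamma> \<in> \<Gamma> \<Longrightarrow> A \<in> sets borel \<Longrightarrow> A \<subseteq> pullback_shadow R \<gamma> \<Longrightarrow>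
        prob A \<le> K * exp (\<delta> * mag \<gamma>) * prob (\<gamma> ` A)"
    by (rule shadow_bounds[OF R]) blast
  obtain K' where K1': "K' \<ge> 1" and K': "\<And>\<gamma> A. \<gamma> \<in> \<Gamma> \<Longrightarrow> A \<in> sets borel \<Longrightarrow> A \<subseteq> pullback_shadow R' \<gamma> \<Longrightarrow>
        prob (\<gamma> ` A) \<le> K' * exp (- \<delta> * mag \<gamma>) * prob A"
    by (rule shadow_bounds[OF R'(1)]) blast
  define L where "L = K * K' / e"
  have L: "L > 0" using K1 K1' e by (simp add: L_def)
  \<comment> \<open>The magnitude cancels: \<open>shadow R' \<gamma>\<close> has measure at most
    \<open>K' * exp (- \<delta> * mag \<gamma>)\<close>, while by the negated claim
    \<open>shadow R \<gamma> - D\<close> has measure more than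
    \<open>e / K * exp (- \<delta> * mag \<gamma>)\<close>. The ratio of the two bounds is
    \<open>L\<close>.\<close>
  have comparison: "prob (shadow R' \<gamma>) \<le> L * prob (shadow R \<gamma> - D)" if \<gamma>: "\<gamma> \<in> \<Gamma>" for \<gamma>
  proof -
    let ?A = "pullback_shadow R \<gamma> - \<gamma> -` D"
    have A: "?A \<in> sets borel" using sets_pullback_shadow[OF \<gamma> R] vimage_borel[OF \<gamma> D] by blast
    have img: "\<gamma> ` ?A = shadow R \<gamma> - D"
      using bij[OF \<gamma>] by (auto simp: pullback_shadow_def bij_is_surj image_set_diff[OF bij_is_inj])
    have "e < prob ?A" using neg \<gamma> by simp
    then have "1 < prob ?A / e" using e by simp
    also have "\<dots> \<le> K * exp (\<delta> * mag \<gamma>) * prob (shadow R \<gamma> - D) / e"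
      using K[OF \<gamma> A] e unfolding img by (intro divide_right_mono) auto
    finally have 1: "1 < K * exp (\<delta> * mag \<gamma>) * prob (shadow R \<gamma> - D) / e" .
    have "prob (shadow R' \<gamma>) \<le> K' * exp (- \<delta> * mag \<gamma>) * prob (pullback_shadow R' \<gamma>)"
      unfolding shadow_eq_image[OF \<gamma>] using sets_pullback_shadow[OF \<gamma> R'(1)]
      by (intro K' \<gamma>) (auto simp: shadow_eq_image[OF \<gamma>, symmetric])
    also have "\<dots> \<le> K' * exp (- \<delta> * mag \<gamma>) * 1" using K1' by (intro mult_left_mono) auto
    also have "\<dots> \<le> K' * exp (- \<delta> * mag \<gamma>) * (K * exp (\<delta> * mag \<gamma>) * prob (shadow R \<gamma> - D) / e)"
      using 1 K1' by (intro mult_left_mono) auto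
    also have "\<dots> = L * prob (shadow R \<gamma> - D)"
      by (simp add: L_def exp_minus field_simps)
    finally show ?thesis .
  qed
  have sh: "shadow R \<gamma> \<in> sets \<mu>" "shadow R' \<gamma> \<in> sets \<mu>" "shadow R \<gamma> - D \<in> sets \<mu>" if "\<gamma> \<in> \<Gamma>" for \<gamma>
    using sets_shadow[OF that] R R'(1) D by (auto simp: sets_eq)
  \<comment> \<open>The enlarged shadows of a Vitali subfamily cover the union. Each is controlled
    by \<open>shadow R \<gamma> - D\<close>, and these sets are disjoint inside
    \<open>V - D\<close>.\<close>
  have finite_bound: "prob (\<Union>\<gamma>\<in>F. shadow R \<gamma>) \<le> L * prob (V - D)"
    if F: "finite F" "F \<subseteq> H R" "\<And>\<gamma>. \<gamma> \<in> F \<Longrightarrow> shadow R \<gamma> \<subseteq> V" and V: "open V" for F V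
  proof -
    obtain S where S: "S \<subseteq> F" "disjoint_family_on (shadow R) S"
      "(\<Union>a\<in>F. shadow R a) \<subseteq> (\<Union>a\<in>S. shadow R' a)"
      using finite_vitali_cover[of F mag "shadow R" "shadow R'"] F(1,2) R'(2) by (metis subsetD)
    have fin: "finite S" and SG: "S \<subseteq> \<Gamma>" using S(1) F HG by (auto intro: finite_subset)
    have VD: "V - D \<in> sets \<mu>" using V D by (auto simp: sets_eq)
    have "prob (\<Union>\<gamma>\<in>F. shadow R \<gamma>) \<le> prob (\<Union>\<gamma>\<in>S. shadow R' \<gamma>)"
      using S(3) fin SG sh(2) by (intro finite_measure_mono sets.finite_UN) auto
    also have "\<dots> \<le> (\<Sum>\<gamma>\<in>S. prob (shadow R' \<gamma>))"
      using fin SG sh(2) by (intro finite_measure_subadditive_finite) auto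
    also have "\<dots> \<le> (\<Sum>\<gamma>\<in>S. L * prob (shadow R \<gamma> - D))"
      using comparison SG by (intro sum_mono) auto
    also have "\<dots> = L * prob (\<Union>\<gamma>\<in>S. shadow R \<gamma> - D)"
    proof -
      have "disjoint_family_on (\<lambda>\<gamma>. shadow R \<gamma> - D) S"
        using S(2) by (auto simp: disjoint_family_on_def)
      then have "prob (\<Union>\<gamma>\<in>S. shadow R \<gamma> - D) = (\<Sum>\<gamma>\<in>S. prob (shadow R \<gamma> - D))"
        using fin SG sh(3) by (intro finite_measure_finite_Union) auto
      then show ?thesis by (simp add: sum_distrib_left)
    qed
    also have "\<dots> \<le> L * prob (V - D)"
    proof (rule mult_left_mono[OF finite_measure_mono[OF _ VD]])
      show "(\<Union>\<gamma>\<in>S. shadow R \<gamma> - D) \<subseteq> V - D" using F(3) S(1) by blast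
    qed (use L in simp)
    finally show ?thesis .
  qed
  have bound: "prob (\<Union>\<gamma>\<in>{\<gamma>\<in>H R. shadow R \<gamma> \<subseteq> V}. shadow R \<gamma>) \<le> L * prob (V - D)" if V: "open V" for V
  proof (cases "{\<gamma>\<in>H R. shadow R \<gamma> \<subseteq> V} = {}")
    case True
    then show ?thesis using L by (simp only: UN_empty) simp
  next
    case False
    let ?G = "{\<gamma>\<in>H R. shadow R \<gamma> \<subseteq> V}"
    have "countable ?G" using HG by (intro countable_subset[OF _ PS4_countable]) auto
    then obtain en :: "nat \<Rightarrow> 'a \<Rightarrow> 'a" where en: "range en = ?G"
      using range_from_nat_into[OF False] by blast
    have enG: "en i \<in> H R" "shadow R (en i) \<subseteq> V" "en i \<in> \<Gamma>" for i
      using rangeI[of en i] HG unfolding en by auto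
    have un: "(\<Union>i\<in>I. shadow R (en i)) \<in> sets \<mu>" for I
      using sh(1) enG by (intro sets.countable_UN') auto
    \<comment> \<open>Continuity from below passes from finite subfamilies to the whole family,
      which is countable by PS4.\<close>
    have "(\<lambda>n. prob (\<Union>i\<le>n. shadow R (en i))) \<longlonglongrightarrow> prob (\<Union>n. \<Union>i\<le>n. shadow R (en i))"
      using un by (intro finite_Lim_measure_incseq) (auto simp: incseq_def intro: order_trans)
    moreover have "(\<Union>n. \<Union>i\<le>n. shadow R (en i)) = (\<Union>\<gamma>\<in>?G. shadow R \<gamma>)"
      unfolding en[symmetric] by auto
    moreover have "prob (\<Union>i\<le>n. shadow R (en i)) \<le> L * prob (V - D)" for n
    proof -
      have "prob (\<Union>\<gamma>\<in>en ` {..n}. shadow R \<gamma>) \<le> L * prob (V - D)"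
        by (rule finite_bound[OF _ _ _ V]) (use enG in auto)
      then show ?thesis by simp
    qed
    ultimately show ?thesis by (auto intro: LIMSEQ_le_const2)
  qed
  obtain M' where M': "AE x in \<mu>. x \<in> M'"
    "\<And>x V. x \<in> M' \<Longrightarrow> x \<in> radial_limit_set R \<Longrightarrow> open V \<Longrightarrow> x \<in> V \<Longrightarrow>
      \<exists>\<gamma>\<in>H R. x \<in> shadow R \<gamma> \<and> shadow R \<gamma> \<subseteq> V"
    by (rule small_shadow[OF R]) blast
  \<comment> \<open>Outer regularity makes \<open>V - D\<close> small, so the shadows inside
    \<open>V\<close> form an open set of small measure that covers the radial points of
    \<open>D\<close> in \<open>M'\<close>. Working with open covers avoids the measurability of
    \<open>radial_limit_set R\<close>.\<close>
  have "\<exists>W. open W \<and> D \<inter> radial_limit_set R \<inter> M' \<subseteq> W \<and> prob W \<le> inverse (real (Suc n))" for n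
  proof -
    have "0 < inverse (real (Suc n)) / L" using L by simp
    then obtain C V where V: "closed C" "open V" "C \<subseteq> D" "D \<subseteq> V" "prob (V - C) < inverse (real (Suc n)) / L"
      using closed_open_regular[OF finite_measure_axioms sets_eq D] by metis
    let ?W = "\<Union>\<gamma>\<in>{\<gamma>\<in>H R. shadow R \<gamma> \<subseteq> V}. shadow R \<gamma>"
    have "V - C \<in> sets \<mu>" using V by (auto simp: sets_eq)
    then have "prob (V - D) \<le> prob (V - C)" using V by (intro finite_measure_mono) auto
    then have "L * prob (V - D) \<le> L * (inverse (real (Suc n)) / L)" using V(5) L by (intro mult_left_mono) auto
    then have "prob ?W \<le> inverse (real (Suc n))" using bound[OF V(2)] L by simp
    moreover have "open ?W" using HG shadow_open[OF _ R] by blast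
    moreover have "D \<inter> radial_limit_set R \<inter> M' \<subseteq> ?W" using M'(2)[OF _ _ V(2)] V(4) by blast
    ultimately show ?thesis by blast
  qed
  then obtain W where W: "\<And>n. open (W n)" "\<And>n. D \<inter> radial_limit_set R \<inter> M' \<subseteq> W n"
    "\<And>n. prob (W n) \<le> inverse (real (Suc n))" by metis
  have mW: "W n \<in> sets \<mu>" for n using W(1)[of n] by (simp add: sets_eq)
  then have m: "(\<Inter>n. W n) \<in> sets \<mu>" by auto
  have "prob (\<Inter>n. W n) \<le> inverse (real (Suc n))" for n
    using finite_measure_mono[of "\<Inter>n. W n" "W n"] mW W(3)[of n] by (meson INF_lower UNIV_I order_trans)
  then have "prob (\<Inter>n. W n) = 0"
    using reals_Archimedean[of "prob (\<Inter>n. W n)"] by (meson not_le zero_less_measure_iff)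
  then have "(\<Inter>n. W n) \<in> null_sets \<mu>" using m by (auto simp: null_sets_def emeasure_eq_measure)
  then have "AE x in \<mu>. x \<notin> (\<Inter>n. W n)" by (rule AE_not_in)
  with M'(1) have "AE x in \<mu>. \<not> (x \<in> D \<and> x \<in> radial_limit_set R)"
    by eventually_elim (use W(2) in blast)
  then show False using nonnull by contradiction
qed

end

section \<open>The transfer function\<close>

text \<open>A countable union \<open>A\<close> of \<open>N\<close>-null sets attains the supremum
  \<open>s\<close> of the \<open>M\<close>-masses of such sets. Off \<open>A\<close> an
  \<open>N\<close>-null set can carry no further mass, so Radon-Nikodym applies there; finiteness of
  \<open>M\<close> makes the density finite almost everywhere.\<close>

lemma lebesgue_decomposition:
  assumes "finite_measure M" "finite_measure N" and sets: "sets M = sets N"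
  obtains A F where "A \<in> null_sets N" "F \<in> borel_measurable N"
    "density M (indicator (space M - A)) = density N F" "AE x in N. F x \<noteq> \<infinity>"
proof -
  interpret M: finite_measure M by fact
  interpret N: finite_measure N by fact
  have bdd: "bdd_above (measure M ` null_sets N)"
    by (rule bdd_aboveI[of _ "measure M (space M)"]) (auto intro: M.bounded_measure)
  define s where "s = (SUP B\<in>null_sets N. measure M B)"
  have "\<exists>B\<in>null_sets N. s - inverse (real (Suc n)) < measure M B" for n
    unfolding s_def by (rule less_cSUP_iff[THEN iffD1]) (use bdd in \<open>auto intro: exI[of _ "{}"]\<close>)
  then obtain B where B: "\<And>n. B n \<in> null_sets N" "\<And>n. s - inverse (real (Suc n)) < measure M (B n)"
    by metis
  define A where "A = (\<Union>n. B n)"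
  have A: "A \<in> null_sets N" unfolding A_def using B(1) by (rule null_sets_UN)
  then have AM: "A \<in> sets M" using sets by auto
  have "s - inverse (real (Suc n)) < measure M A" for n
  proof -
    have "measure M (B n) \<le> measure M A" using AM by (intro M.finite_measure_mono) (auto simp: A_def)
    then show ?thesis using B(2)[of n] by simp
  qed
  then have sA: "s \<le> measure M A"
    using reals_Archimedean[of "s - measure M A"] by (smt (verit))
  have zero: "emeasure M (S - A) = 0" if S: "S \<in> null_sets N" for S
  proof -
    have SM: "S - A \<in> sets M" using S AM sets by auto
    have "measure M A + measure M (S - A) = measure M (A \<union> (S - A))"
      using AM SM by (intro M.finite_measure_Union[symmetric]) auto
    also have "\<dots> \<le> s"
      unfolding s_def using S A by (intro cSUP_upper bdd) auto
    finally have "measure M (S - A) = 0" using sA measure_nonneg[of M "S - A"] by linarith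
    then show ?thesis by (simp add: M.emeasure_eq_measure)
  qed
  define M' where "M' = density M (indicator (space M - A))"
  have M': "emeasure M' S = emeasure M (S - A)" if "S \<in> sets M" for S
  proof -
    have "emeasure M' S = emeasure M ((space M - A) \<inter> S)"
      unfolding M'_def using that AM by (subst emeasure_density) (auto simp flip: indicator_inter_arith)
    also have "(space M - A) \<inter> S = S - A" using sets.sets_into_space[OF that] by auto
    finally show ?thesis .
  qed
  have "absolutely_continuous N M'"
    unfolding absolutely_continuous_def
  proof
    fix S assume S: "S \<in> null_sets N"
    then have "S \<in> sets M" using sets by auto
    with M'[OF this] zero[OF S] show "S \<in> null_sets M'" by (auto simp: null_sets_def M'_def)
  qed
  moreover have "sets M' = sets N" using sets by (simp add: M'_def)
  ultimately obtain F where F: "F \<in> borel_measurable N" "density N F = M'"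
    using N.Radon_Nikodym by blast
  have "(\<integral>\<^sup>+x. F x \<partial>N) = emeasure (density N F) (space N)"
    using F(1) by (subst emeasure_density) (auto intro!: nn_integral_cong)
  also have "\<dots> = emeasure M (space M - A)"
    unfolding F(2) using M'[OF sets.top] sets_eq_imp_space_eq[OF sets] by simp
  also have "\<dots> \<noteq> \<infinity>" by simp
  finally have "AE x in N. F x \<noteq> \<infinity>" using nn_integral_PInf_AE[OF F(1)] by blast
  then show thesis using that[OF A F(1)] F(2) by (simp add: M'_def)
qed

text \<open>Taking logarithms in \<open>eq\<close> turns the two multiplicative errors into additive
  ones. Later \<open>a\<close> and \<open>j\<close> are the Jacobians of the two actions, and
  \<open>w\<close>, \<open>v\<close> are the values of the transfer density at
  \<open>\<gamma> x\<close> and \<open>x\<close>.\<close>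

lemma ln_comparison:
  fixes a j :: ennreal
  assumes "C \<ge> 1" "D \<ge> 1" "v > 0" "w > 0"
    and a: "ennreal (inverse C * exp (- s)) \<le> a" "a \<le> ennreal (C * exp (- s))"
    and j: "ennreal (inverse D * exp (- t)) \<le> j" "j \<le> ennreal (D * exp (- t))"
    and eq: "a = ennreal w / ennreal v * j"
  shows "\<bar>s - t + (ln w - ln v)\<bar> \<le> ln C + ln D"
proof -
  have "j < \<top>" using j(2) by (rule le_less_trans) simp
  then obtain r where r: "r \<ge> 0" "j = ennreal r" by (cases j) auto
  have "inverse D * exp (- t) \<le> r" using j(1) r by (simp add: ennreal_le_iff)
  moreover have "0 < inverse D * exp (- t)" using assms by simp
  ultimately have r0: "r > 0" by linarith
  have a': "a = ennreal (w / v * r)"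
  proof -
    have "a = ennreal (w / v) * ennreal r" using assms(3,4) by (simp add: eq r(2) divide_ennreal)
    also have "\<dots> = ennreal (w / v * r)" using assms(3,4) r(1) by (intro ennreal_mult[symmetric]) auto
    finally show ?thesis .
  qed
  have "inverse C * exp (- s) \<le> w / v * r" "w / v * r \<le> C * exp (- s)"
    "inverse D * exp (- t) \<le> r" "r \<le> D * exp (- t)"
    using a j assms r0 by (simp_all add: a' r ennreal_le_iff)
  then have "ln (inverse C * exp (- s)) \<le> ln (w / v * r)" "ln (w / v * r) \<le> ln (C * exp (- s))"
    "ln (inverse D * exp (- t)) \<le> ln r" "ln r \<le> ln (D * exp (- t))"
    using assms r0 by (auto intro!: ln_mono)
  then have "- ln C - s \<le> ln w - ln v + ln r" "ln w - ln v + ln r \<le> ln C - s"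
    "- ln D - t \<le> ln r" "ln r \<le> ln D - t"
    using assms r0 by (simp_all add: ln_mult ln_inverse ln_div)
  then show ?thesis by linarith
qed

section \<open>The push-forward measure and the comparison of the two cocycles\<close>

context PS_pair
begin

text \<open>Extending \<open>f\<close> by a constant off \<open>Y\<close> gives a map that is
  measurable on the whole space, so integrals need no restricted measure.\<close>

definition f' :: "'a \<Rightarrow> 'b" where "f' x = (if x \<in> Y then f x else undefined)"

definition \<nu> :: "'b measure" where "\<nu> = distr \<mu>\<^sub>1 borel f'"

lemma f'_measurable [measurable]: "f' \<in> \<mu>\<^sub>1 \<rightarrow>\<^sub>M borel"
  using f_measurable measurable_restrict_space_iff[of Y \<mu>\<^sub>1 undefined borel f] Y_borel
  by (simp add: P1.sets_eq P1.space_eq f'_def[abs_def])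

lemma \<nu>_eq: "distr (restrict_space \<mu>\<^sub>1 Y) borel f = \<nu>"
proof (rule measure_eqI)
  fix A :: "'b set" assume "A \<in> sets (distr (restrict_space \<mu>\<^sub>1 Y) borel f)"
  then have A: "A \<in> sets borel" by simp
  have "emeasure (distr (restrict_space \<mu>\<^sub>1 Y) borel f) A = emeasure \<mu>\<^sub>1 (f -` A \<inter> Y)"
    using Y_borel A f_measurable
    by (subst emeasure_distr) (auto simp: space_restrict_space P1.space_eq P1.sets_eq intro!: emeasure_restrict_space)
  also have "\<dots> = emeasure \<mu>\<^sub>1 (f' -` A)"
  proof (rule emeasure_eq_AE)
    show "AE x in \<mu>\<^sub>1. x \<in> f -` A \<inter> Y \<longleftrightarrow> x \<in> f' -` A"
      using Y_full by eventually_elim (auto simp: f'_def)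
    show "f' -` A \<in> P1.events" using measurable_sets[OF f'_measurable A] P1.space_eq by simp
    show "f -` A \<inter> Y \<in> P1.events"
      using measurable_sets[OF f_measurable A] Y_borel
      by (simp add: space_restrict_space P1.space_eq sets_restrict_space_iff P1.sets_eq)
  qed
  also have "\<dots> = emeasure \<nu> A" unfolding \<nu>_def using A by (simp add: emeasure_distr P1.space_eq)
  finally show "emeasure (distr (restrict_space \<mu>\<^sub>1 Y) borel f) A = emeasure \<nu> A" .
qed (simp add: \<nu>_def)

lemma borel_preimage:
  assumes "B \<in> sets borel"
  obtains S where "S \<in> sets borel" "AE x in \<mu>\<^sub>1. x \<in> B \<longleftrightarrow> f' x \<in> S"
proof -
  have "P1.prob (UNIV - Y) = 0"
    using P1.prob_compl[of Y] P1.AE_in_set_eq_1[of Y] Y_full Y_borel by (simp add: P1.sets_eq P1.space_eq)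
  then obtain S where S: "S \<in> sets borel" "sym_diff B (Y \<inter> f -` S) \<in> null_sets \<mu>\<^sub>1"
    using injective_measurable_preimage[OF P1.finite_measure_axioms P1.sets_eq P1.compact_space
      P2.compact_space Y_borel _ f_measurable f_inj assms] by blast
  from AE_not_in[OF S(2)] Y_full have "AE x in \<mu>\<^sub>1. x \<in> B \<longleftrightarrow> f' x \<in> S"
    by eventually_elim (auto simp: f'_def)
  with S(1) show thesis by (rule that)
qed

text \<open>All clauses come from the density \<open>F\<close>. A \<open>\<mu>\<^sub>2\<close>-null
  set has no \<open>F\<close>-mass, which transfers almost sure statements;
  \<open>\<rho> \<gamma>\<close> preserves null sets, which gives the invariance of
  \<open>E\<close>; and the Jacobian identity \<open>jac_eq\<close> becomes the last clause after
  taking logarithms.\<close>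

lemma transfer_cocycle:
  assumes nonsing: "\<not> mutually_singular (distr (restrict_space \<mu>\<^sub>1 Y) borel f) \<mu>\<^sub>2"
  obtains E and u :: "'a \<Rightarrow> real" and C
  where "E \<in> sets borel" "E \<subseteq> Y" "u \<in> borel_measurable borel" "\<not> (AE x in \<mu>\<^sub>1. x \<notin> E)"
    "\<And>P. AE y in \<mu>\<^sub>2. P y \<Longrightarrow> AE x in \<mu>\<^sub>1. x \<in> E \<longrightarrow> P (f x)"
    "\<And>\<gamma>. \<gamma> \<in> \<Gamma>\<^sub>1 \<Longrightarrow> AE x in \<mu>\<^sub>1. \<gamma> x \<in> E \<longrightarrow> x \<in> E"
    "\<And>\<gamma>. \<gamma> \<in> \<Gamma>\<^sub>1 \<Longrightarrow> AE x in \<mu>\<^sub>1. x \<in> E \<longrightarrow> \<gamma> x \<in> E \<longrightarrow>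
        \<bar>\<delta>\<^sub>1 * \<sigma>\<^sub>1 \<gamma> x - \<delta>\<^sub>2 * \<sigma>\<^sub>2 (\<rho> \<gamma>) (f x) + (u (\<gamma> x) - u x)\<bar> \<le> C"
proof -
  interpret \<nu>: prob_space \<nu> unfolding \<nu>_def by (rule P1.prob_space_distr) simp
  have sets_\<nu>: "sets \<nu> = sets \<mu>\<^sub>2" by (simp add: \<nu>_def P2.sets_eq)
  have space_\<nu>: "space \<nu> = UNIV" by (simp add: \<nu>_def)
  obtain A F where A: "A \<in> null_sets \<mu>\<^sub>2" and F0: "F \<in> borel_measurable \<mu>\<^sub>2"
    and dens: "density \<nu> (indicator (space \<nu> - A)) = density \<mu>\<^sub>2 F" and Ffin: "AE x in \<mu>\<^sub>2. F x \<noteq> \<infinity>"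
    using lebesgue_decomposition[OF \<nu>.finite_measure_axioms P2.finite_measure_axioms sets_\<nu>] by metis
  have F [measurable]: "F \<in> borel_measurable borel" using F0 measurable_cong_sets[OF P2.sets_eq refl] by blast
  have A_borel [measurable]: "A \<in> sets borel" using A P2.sets_eq by auto
  \<comment> \<open>Excluded are \<open>A\<close>, which carries the singular part of the
    push-forward, and the points where \<open>F\<close> has no finite logarithm.\<close>
  define E2 where "E2 = {y. y \<notin> A \<and> 0 < F y \<and> F y < \<infinity>}"
  have E2 [measurable]: "E2 \<in> sets borel"
  proof -
    have "{y \<in> space borel. y \<notin> A \<and> 0 < F y \<and> F y < \<infinity>} \<in> sets borel" by measurable
    then show ?thesis by (simp add: E2_def)
  qed
  have integral_\<nu>: "(\<integral>\<^sup>+x. indicator (- A) (f' x) * g (f' x) \<partial>\<mu>\<^sub>1) = (\<integral>\<^sup>+y. F y * g y \<partial>\<mu>\<^sub>2)"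
    if g [measurable]: "g \<in> borel_measurable borel" for g
  proof -
    have g2: "g \<in> borel_measurable \<mu>\<^sub>2" using g measurable_cong_sets[OF P2.sets_eq refl] by blast
    have g\<nu>: "g \<in> borel_measurable \<nu>" using g by (simp add: \<nu>_def measurable_distr_eq1)
    have "(\<integral>\<^sup>+x. indicator (- A) (f' x) * g (f' x) \<partial>\<mu>\<^sub>1) = (\<integral>\<^sup>+y. indicator (- A) y * g y \<partial>\<nu>)"
      unfolding \<nu>_def by (rule nn_integral_distr[symmetric]) (rule f'_measurable, simp only: measurable_distr_eq1, measurable)
    also have "\<dots> = (\<integral>\<^sup>+y. g y \<partial>density \<nu> (indicator (space \<nu> - A)))"
    proof -
      have "UNIV - A \<in> sets \<nu>" using A_borel by (simp add: sets_\<nu> P2.sets_eq)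
      then have "(indicator (UNIV - A) :: 'b \<Rightarrow> ennreal) \<in> borel_measurable \<nu>"
        by (rule borel_measurable_indicator)
      then show ?thesis
        using g\<nu> by (subst nn_integral_density) (simp_all add: space_\<nu> Compl_eq_Diff_UNIV)
    qed
    also have "\<dots> = (\<integral>\<^sup>+y. F y * g y \<partial>\<mu>\<^sub>2)"
      unfolding dens by (rule nn_integral_density[OF F0 g2])
    finally show ?thesis .
  qed
  \<comment> \<open>Up to a null set, \<open>f'\<close> can hit a set without \<open>F\<close>-mass
    only inside \<open>A\<close>.\<close>
  have null: "AE x in \<mu>\<^sub>1. f' x \<in> A \<or> f' x \<notin> S" if S [measurable]: "S \<in> sets borel"
    and z: "(\<integral>\<^sup>+y. F y * indicator S y \<partial>\<mu>\<^sub>2) = 0" for S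
  proof -
    have "(\<integral>\<^sup>+x. indicator (- A) (f' x) * indicator S (f' x) \<partial>\<mu>\<^sub>1) = 0"
      using integral_\<nu>[of "indicator S"] z by simp
    then have "AE x in \<mu>\<^sub>1. (indicator (- A) (f' x) * indicator S (f' x) :: ennreal) = 0"
      by (subst (asm) nn_integral_0_iff_AE) measurable
    then show ?thesis by eventually_elim (auto simp: indicator_def split: if_splits)
  qed
  have outside: "AE x in \<mu>\<^sub>1. f' x \<in> A \<or> f' x \<in> E2"
  proof -
    have "AE y in \<mu>\<^sub>2. y \<notin> A" using A by (rule AE_not_in)
    with Ffin have "AE y in \<mu>\<^sub>2. F y * indicator (- E2) y = 0"
      by eventually_elim (auto simp: E2_def indicator_def top.not_eq_extremum)
    then have "(\<integral>\<^sup>+y. F y * indicator (- E2) y \<partial>\<mu>\<^sub>2) = (\<integral>\<^sup>+y. 0 \<partial>\<mu>\<^sub>2)" by (rule nn_integral_cong_AE)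
    then show ?thesis using null[of "- E2"] by simp
  qed
  define E where "E = {x \<in> Y. f x \<in> E2}"
  have E_iff: "x \<in> E \<longleftrightarrow> x \<in> Y \<and> f' x \<in> E2" for x by (auto simp: E_def f'_def)
  have [measurable]: "Y \<in> sets \<mu>\<^sub>1" using Y_borel P1.sets_eq by simp
  have E_borel [measurable]: "E \<in> sets \<mu>\<^sub>1"
  proof -
    have "{x \<in> space \<mu>\<^sub>1. x \<in> Y \<and> f' x \<in> E2} \<in> sets \<mu>\<^sub>1" by measurable
    then show ?thesis by (simp add: E_iff set_eq_iff P1.space_eq flip: E_iff cong: conj_cong)
  qed
  have transfer: "AE x in \<mu>\<^sub>1. x \<in> E \<longrightarrow> P (f x)" if P: "AE y in \<mu>\<^sub>2. P y" for P
  proof -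
    obtain N where N: "{y \<in> space \<mu>\<^sub>2. \<not> P y} \<subseteq> N" "emeasure \<mu>\<^sub>2 N = 0" "N \<in> sets \<mu>\<^sub>2"
      using AE_E[OF P] by blast
    then have "AE y in \<mu>\<^sub>2. y \<notin> N" by (intro AE_not_in) auto
    then have "AE y in \<mu>\<^sub>2. F y * indicator N y = 0" by eventually_elim auto
    then have "(\<integral>\<^sup>+y. F y * indicator N y \<partial>\<mu>\<^sub>2) = (\<integral>\<^sup>+y. 0 \<partial>\<mu>\<^sub>2)" by (rule nn_integral_cong_AE)
    then have "AE x in \<mu>\<^sub>1. f' x \<in> A \<or> f' x \<notin> N" using null[of N] N(3) by (simp add: P2.sets_eq)
    then show ?thesis
      by eventually_elim (use N(1) P2.space_eq in \<open>auto simp: E_def E2_def f'_def\<close>)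
  qed
  \<comment> \<open>If \<open>E\<close> were null, \<open>outside\<close> would concentrate the
    push-forward on the \<open>\<mu>\<^sub>2\<close>-null set \<open>A\<close>.\<close>
  have nonnull: "\<not> (AE x in \<mu>\<^sub>1. x \<notin> E)"
  proof
    assume "AE x in \<mu>\<^sub>1. x \<notin> E"
    with outside Y_full have "AE x in \<mu>\<^sub>1. f' x \<notin> - A"
      by eventually_elim (auto simp: E_iff)
    then have "AE y in \<nu>. y \<notin> - A"
      unfolding \<nu>_def by (subst AE_distr_iff) (simp_all add: A_borel)
    then have "emeasure \<nu> (- A) = 0"
      using AE_iff_measurable[of "- A" \<nu> "\<lambda>y. y \<notin> - A"] A_borel by (auto simp: \<nu>_def)
    moreover have "emeasure \<mu>\<^sub>2 (space \<mu>\<^sub>2 - (- A)) = 0" using null_setsD1[OF A] by (simp add: P2.space_eq Diff_eq)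
    moreover have "- A \<in> sets borel" using A_borel by simp
    ultimately have "mutually_singular \<nu> \<mu>\<^sub>2"
      unfolding mutually_singular_def by (intro exI[of _ "- A"]) (simp add: sets_\<nu> P2.sets_eq)
    then show False using nonsing \<nu>_eq by simp
  qed
  \<comment> \<open>The image of \<open>A\<close> under \<open>\<rho> \<gamma>\<close> is
    \<open>\<mu>\<^sub>2\<close>-null, hence almost surely missed by \<open>f (\<gamma> x)\<close>
    when \<open>\<gamma> x\<close> is in \<open>E\<close>. So \<open>f x\<close> is not in
    \<open>A\<close>, and \<open>outside\<close> places it in \<open>E2\<close>.\<close>
  have invariant: "AE x in \<mu>\<^sub>1. \<gamma> x \<in> E \<longrightarrow> x \<in> E" if \<gamma>: "\<gamma> \<in> \<Gamma>\<^sub>1" for \<gamma>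
  proof -
    have \<rho>\<gamma>: "\<rho> \<gamma> \<in> \<Gamma>\<^sub>2" using \<gamma> by (rule \<rho>_mem)
    have "AE y in \<mu>\<^sub>2. inv_into UNIV (\<rho> \<gamma>) y \<notin> A"
      by (rule P2.AE_comp[OF P2.inv_mem[OF \<rho>\<gamma>] AE_not_in[OF A]])
    from P1.AE_comp[OF \<gamma> transfer[OF this]] outside Y_full show ?thesis
    proof eventually_elim
      case (elim x)
      show ?case
      proof
        assume "\<gamma> x \<in> E"
        then have "inv_into UNIV (\<rho> \<gamma>) (\<rho> \<gamma> (f x)) \<notin> A" using elim f_equivariant[OF \<gamma>] by simp
        then show "x \<in> E" using elim \<rho>\<gamma> by (simp add: E_iff f'_def)
      qed
    qed
  qed
  define u where "u x = ln (enn2real (F (f' x)))" for x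
  have jac_eq: "AE x in \<mu>\<^sub>1. x \<in> E \<longrightarrow> \<gamma> x \<in> E \<longrightarrow>
      P1.jac \<gamma> x = F (f (\<gamma> x)) / F (f x) * P2.jac (\<rho> \<gamma>) (f x)" if \<gamma>: "\<gamma> \<in> \<Gamma>\<^sub>1" for \<gamma>
  proof -
    have \<rho>\<gamma>: "\<rho> \<gamma> \<in> \<Gamma>\<^sub>2" using \<gamma> by (rule \<rho>_mem)
    have [measurable]: "\<rho> \<gamma> \<in> borel_measurable borel" "inv_into UNIV (\<rho> \<gamma>) \<in> borel_measurable borel"
      using P2.measurable \<rho>\<gamma> P2.inv_mem by auto
    have [measurable]: "P2.jac (\<rho> \<gamma>) \<in> borel_measurable borel"
      using P2.jac_measurable measurable_cong_sets[OF P2.sets_eq refl] by blast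
    \<comment> \<open>On \<open>T\<close> both \<open>F y\<close> and
      \<open>F (\<rho> \<gamma> y)\<close> are positive and finite, so the quotient in
      \<open>b\<close> can be cancelled.\<close>
    define T where "T = E2 \<inter> \<rho> \<gamma> -` E2"
    have T [measurable]: "T \<in> sets borel" unfolding T_def using P2.vimage_borel[OF \<rho>\<gamma> E2] E2 by blast
    define b where "b y = F (\<rho> \<gamma> y) / F y * P2.jac (\<rho> \<gamma>) y" for y
    have b [measurable]: "b \<in> borel_measurable borel" unfolding b_def by measurable
    \<comment> \<open>Equal measures have almost everywhere equal densities. To compare them on an
      arbitrary \<open>B\<close>, the set is first replaced by a preimage under \<open>f'\<close>,
      so that its measure can be computed in \<open>\<mu>\<^sub>2\<close>.\<close>
    have "density \<mu>\<^sub>1 (\<lambda>x. P1.jac \<gamma> x * indicator T (f' x)) = density \<mu>\<^sub>1 (\<lambda>x. b (f' x) * indicator T (f' x))"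
    proof (rule measure_eqI)
      fix B assume "B \<in> sets (density \<mu>\<^sub>1 (\<lambda>x. P1.jac \<gamma> x * indicator T (f' x)))"
      then have B [measurable]: "B \<in> sets \<mu>\<^sub>1" by simp
      then obtain S where S [measurable]: "S \<in> sets borel" and BS: "AE x in \<mu>\<^sub>1. x \<in> B \<longleftrightarrow> f' x \<in> S"
        using borel_preimage P1.sets_eq by metis
      define S' where "S' = S \<inter> T"
      have S' [measurable]: "S' \<in> sets borel" unfolding S'_def by measurable
      have YS: "{x \<in> Y. f x \<in> S'} \<in> sets borel"
      proof -
        have "{x \<in> space \<mu>\<^sub>1. x \<in> Y \<and> f' x \<in> S'} \<in> sets \<mu>\<^sub>1" by measurable
        moreover have "{x \<in> space \<mu>\<^sub>1. x \<in> Y \<and> f' x \<in> S'} = {x \<in> Y. f x \<in> S'}"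
          by (auto simp: P1.space_eq f'_def)
        ultimately show ?thesis by (simp add: P1.sets_eq)
      qed
      have img: "\<gamma> ` {x \<in> Y. f x \<in> S'} = {x \<in> Y. f x \<in> \<rho> \<gamma> ` S'}"
      proof (rule Set.set_eqI)
        fix x
        show "x \<in> \<gamma> ` {x \<in> Y. f x \<in> S'} \<longleftrightarrow> x \<in> {x \<in> Y. f x \<in> \<rho> \<gamma> ` S'}"
        proof
          assume "x \<in> \<gamma> ` {x \<in> Y. f x \<in> S'}"
          then show "x \<in> {x \<in> Y. f x \<in> \<rho> \<gamma> ` S'}"
            using f_equivariant[OF \<gamma>] Y_mem_iff[OF \<gamma>] by auto
        next
          assume x: "x \<in> {x \<in> Y. f x \<in> \<rho> \<gamma> ` S'}"
          then obtain y where y: "y \<in> Y" "x = \<gamma> y" using Y_invariant[OF \<gamma>] by blast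
          then have "\<rho> \<gamma> (f y) \<in> \<rho> \<gamma> ` S'" using x f_equivariant[OF \<gamma>] by auto
          then have "f y \<in> S'" using P2.bij[OF \<rho>\<gamma>] by (simp add: bij_is_inj inj_image_mem_iff)
          then show "x \<in> \<gamma> ` {x \<in> Y. f x \<in> S'}" using y by blast
        qed
      qed
      \<comment> \<open>The chain goes over to \<open>\<mu>\<^sub>2\<close> by
        \<open>integral_\<nu>\<close>, changes variables by \<open>\<rho> \<gamma>\<close> there and
        comes back by \<open>integral_\<nu>\<close>. Splitting off the factor \<open>F y\<close>
        prepares the return.\<close>
      have "emeasure (density \<mu>\<^sub>1 (\<lambda>x. P1.jac \<gamma> x * indicator T (f' x))) B
          = (\<integral>\<^sup>+x. P1.jac \<gamma> x * indicator T (f' x) * indicator B x \<partial>\<mu>\<^sub>1)"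
        by (rule emeasure_density) measurable
      also have "\<dots> = (\<integral>\<^sup>+x. P1.jac \<gamma> x * indicator {x \<in> Y. f x \<in> S'} x \<partial>\<mu>\<^sub>1)"
        by (rule nn_integral_cong_AE, use BS Y_full in eventually_elim)
          (auto simp: S'_def f'_def indicator_def)
      also have "\<dots> = emeasure \<mu>\<^sub>1 {x \<in> Y. f x \<in> \<rho> \<gamma> ` S'}"
        using P1.emeasure_image[OF \<gamma> YS] by (simp add: img)
      also have "\<dots> = (\<integral>\<^sup>+x. indicator {x \<in> Y. f x \<in> \<rho> \<gamma> ` S'} x \<partial>\<mu>\<^sub>1)"
        using P1.image_borel[OF \<gamma> YS] by (simp add: img P1.sets_eq)
      also have "\<dots> = (\<integral>\<^sup>+x. indicator (- A) (f' x) * indicator (\<rho> \<gamma> ` S') (f' x) \<partial>\<mu>\<^sub>1)"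
        by (rule nn_integral_cong_AE, use Y_full in eventually_elim)
          (auto simp: S'_def T_def E2_def f'_def indicator_def)
      also have "\<dots> = (\<integral>\<^sup>+y. F y * indicator (\<rho> \<gamma> ` S') y \<partial>\<mu>\<^sub>2)"
        using P2.image_borel[OF \<rho>\<gamma> S'] by (intro integral_\<nu>) simp
      also have "\<dots> = (\<integral>\<^sup>+y. F (\<rho> \<gamma> (inv_into UNIV (\<rho> \<gamma>) y)) * indicator S' (inv_into UNIV (\<rho> \<gamma>) y) \<partial>\<mu>\<^sub>2)"
        using \<rho>\<gamma> by (intro nn_integral_cong) (auto simp: P2.image_eq_vimage indicator_def)
      also have "\<dots> = (\<integral>\<^sup>+y. P2.jac (\<rho> \<gamma>) y * (F (\<rho> \<gamma> y) * indicator S' y) \<partial>\<mu>\<^sub>2)"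
        by (rule P2.nn_integral_inv[OF \<rho>\<gamma>]) measurable
      also have "\<dots> = (\<integral>\<^sup>+y. F y * (b y * indicator S' y) \<partial>\<mu>\<^sub>2)"
      proof (rule nn_integral_cong)
        fix y
        show "P2.jac (\<rho> \<gamma>) y * (F (\<rho> \<gamma> y) * indicator S' y) = F y * (b y * indicator S' y)"
        proof (cases "y \<in> S'")
          case True
          then have "0 < F y" "F y < \<top>" by (auto simp: S'_def T_def E2_def)
          then have "F (\<rho> \<gamma> y) * F y / F y = F (\<rho> \<gamma> y)"
            by (intro mult_divide_eq_ennreal) auto
          then have "F y * (F (\<rho> \<gamma> y) / F y) = F (\<rho> \<gamma> y)"
            by (simp add: ennreal_times_divide mult.commute)
          then have "F y * b y = F (\<rho> \<gamma> y) * P2.jac (\<rho> \<gamma>) y"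
            by (simp add: b_def mult.assoc[symmetric])
          then show ?thesis using True by (simp add: mult.commute)
        qed simp
      qed
      also have "\<dots> = (\<integral>\<^sup>+x. indicator (- A) (f' x) * (b (f' x) * indicator S' (f' x)) \<partial>\<mu>\<^sub>1)"
        by (rule integral_\<nu>[symmetric]) measurable
      also have "\<dots> = (\<integral>\<^sup>+x. b (f' x) * indicator T (f' x) * indicator B x \<partial>\<mu>\<^sub>1)"
        by (rule nn_integral_cong_AE, use BS in eventually_elim)
          (auto simp: S'_def T_def E2_def indicator_def)
      also have "\<dots> = emeasure (density \<mu>\<^sub>1 (\<lambda>x. b (f' x) * indicator T (f' x))) B"
        by (rule emeasure_density[symmetric]) measurable
      finally show "emeasure (density \<mu>\<^sub>1 (\<lambda>x. P1.jac \<gamma> x * indicator T (f' x))) B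
          = emeasure (density \<mu>\<^sub>1 (\<lambda>x. b (f' x) * indicator T (f' x))) B" .
    qed simp
    then have "AE x in \<mu>\<^sub>1. P1.jac \<gamma> x * indicator T (f' x) = b (f' x) * indicator T (f' x)"
      by (subst (asm) P1.density_unique_iff) measurable
    then show ?thesis
    proof eventually_elim
      case (elim x)
      show ?case
      proof (intro impI)
        assume x: "x \<in> E" "\<gamma> x \<in> E"
        then have "x \<in> Y" "f' x = f x" "f (\<gamma> x) = \<rho> \<gamma> (f x)" using f_equivariant[OF \<gamma>] by (auto simp: E_def f'_def)
        moreover have "f x \<in> T" using x calculation by (auto simp: T_def E_def)
        ultimately show "P1.jac \<gamma> x = F (f (\<gamma> x)) / F (f x) * P2.jac (\<rho> \<gamma>) (f x)"
          using elim by (simp add: b_def)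
      qed
    qed
  qed
  obtain C1 where C1: "C1 \<ge> 1" "\<And>\<gamma>. \<gamma> \<in> \<Gamma>\<^sub>1 \<Longrightarrow> AE x in \<mu>\<^sub>1.
      ennreal (inverse C1 * exp (- \<delta>\<^sub>1 * \<sigma>\<^sub>1 \<gamma> x)) \<le> P1.jac \<gamma> x \<and> P1.jac \<gamma> x \<le> ennreal (C1 * exp (- \<delta>\<^sub>1 * \<sigma>\<^sub>1 \<gamma> x))"
    by (rule P1.jac_bounds) blast
  obtain C2 where C2: "C2 \<ge> 1" "\<And>\<gamma>. \<gamma> \<in> \<Gamma>\<^sub>2 \<Longrightarrow> AE x in \<mu>\<^sub>2.
      ennreal (inverse C2 * exp (- \<delta>\<^sub>2 * \<sigma>\<^sub>2 \<gamma> x)) \<le> P2.jac \<gamma> x \<and> P2.jac \<gamma> x \<le> ennreal (C2 * exp (- \<delta>\<^sub>2 * \<sigma>\<^sub>2 \<gamma> x))"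
    by (rule P2.jac_bounds) blast
  have cocycle: "AE x in \<mu>\<^sub>1. x \<in> E \<longrightarrow> \<gamma> x \<in> E \<longrightarrow>
      \<bar>\<delta>\<^sub>1 * \<sigma>\<^sub>1 \<gamma> x - \<delta>\<^sub>2 * \<sigma>\<^sub>2 (\<rho> \<gamma>) (f x) + (u (\<gamma> x) - u x)\<bar> \<le> ln C1 + ln C2" if \<gamma>: "\<gamma> \<in> \<Gamma>\<^sub>1" for \<gamma>
    using jac_eq[OF \<gamma>] C1(2)[OF \<gamma>] transfer[OF C2(2)[OF \<rho>_mem[OF \<gamma>]]]
  proof eventually_elim
    case (elim x)
    show ?case
    proof (intro impI)
      assume x: "x \<in> E" "\<gamma> x \<in> E"
      have pos: "enn2real (F (f z)) > 0" "F (f z) = ennreal (enn2real (F (f z)))" "f' z = f z" if "z \<in> E" for z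
        using that by (auto simp: E_def E2_def f'_def enn2real_positive_iff)
      have "P1.jac \<gamma> x = ennreal (enn2real (F (f (\<gamma> x)))) / ennreal (enn2real (F (f x))) * P2.jac (\<rho> \<gamma>) (f x)"
        using elim(1) x pos(2)[OF x(1)] pos(2)[OF x(2)] by simp
      from ln_comparison[OF C1(1) C2(1) pos(1)[OF x(1)] pos(1)[OF x(2)] _ _ _ _ this,
          of "\<delta>\<^sub>1 * \<sigma>\<^sub>1 \<gamma> x" "\<delta>\<^sub>2 * \<sigma>\<^sub>2 (\<rho> \<gamma>) (f x)"]
      show "\<bar>\<delta>\<^sub>1 * \<sigma>\<^sub>1 \<gamma> x - \<delta>\<^sub>2 * \<sigma>\<^sub>2 (\<rho> \<gamma>) (f x) + (u (\<gamma> x) - u x)\<bar> \<le> ln C1 + ln C2"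
        using elim(2,3) x pos(3)[OF x(1)] pos(3)[OF x(2)] by (simp add: u_def)
    qed
  qed
  have "u \<in> borel_measurable \<mu>\<^sub>1" unfolding u_def by measurable
  then have "u \<in> borel_measurable borel" using measurable_cong_sets[OF P1.sets_eq refl] by blast
  moreover have "E \<in> sets borel" "E \<subseteq> Y" using E_borel P1.sets_eq by (auto simp: E_def)
  ultimately show thesis using that[of E u "ln C1 + ln C2"] nonnull transfer invariant cocycle by blast
qed

end

section \<open>Boundedness of the magnitude difference\<close>

context PS_pair
begin

text \<open>The conical limit set is a countable union of translates of radial sets with positive
  integer radius. If \<open>E\<close> met every such radial set in a null set, invariance would
  spread this to all translates and \<open>E\<close> itself would be null.\<close>

lemma conical_nonnull:
  assumes conical: "measure \<mu>\<^sub>1 (conical_limit_set \<Gamma>\<^sub>1 shadow\<^sub>1 H\<^sub>1) = 1"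
    and nonnull: "\<not> (AE x in \<mu>\<^sub>1. x \<notin> E)"
    and invariant: "\<And>\<gamma>. \<gamma> \<in> \<Gamma>\<^sub>1 \<Longrightarrow> AE x in \<mu>\<^sub>1. \<gamma> x \<in> E \<longrightarrow> x \<in> E"
  obtains k :: nat where "\<not> (AE x in \<mu>\<^sub>1. \<not> (x \<in> E \<and> x \<in> P1.radial_limit_set (real (Suc k))))"
proof (rule ccontr)
  assume "\<not> thesis"
  with that have "\<And>k. AE x in \<mu>\<^sub>1. \<not> (x \<in> E \<and> x \<in> P1.radial_limit_set (real (Suc k)))" by blast
  then have all: "AE x in \<mu>\<^sub>1. \<forall>k. \<not> (x \<in> E \<and> x \<in> P1.radial_limit_set (real (Suc k)))"
    unfolding AE_all_countable by blast
  \<comment> \<open>Invariance is evaluated at the inverse translate of \<open>x\<close>: a point of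
    \<open>E\<close> has its inverse translate in \<open>E\<close> as well.\<close>
  have "AE x in \<mu>\<^sub>1. x \<in> E \<longrightarrow> (\<forall>k. inv_into UNIV \<gamma> x \<notin> P1.radial_limit_set (real (Suc k)))"
    if \<gamma>: "\<gamma> \<in> \<Gamma>\<^sub>1" for \<gamma>
    using P1.AE_comp[OF P1.inv_mem[OF \<gamma>] all] P1.AE_comp[OF P1.inv_mem[OF \<gamma>] invariant[OF \<gamma>]]
    by eventually_elim (use \<gamma> in auto)
  then have "AE x in \<mu>\<^sub>1. \<forall>\<gamma>\<in>\<Gamma>\<^sub>1. x \<in> E \<longrightarrow> (\<forall>k. inv_into UNIV \<gamma> x \<notin> P1.radial_limit_set (real (Suc k)))"
    unfolding AE_ball_countable[OF P1.PS4_countable] by blast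
  moreover have "AE x in \<mu>\<^sub>1. x \<in> conical_limit_set \<Gamma>\<^sub>1 shadow\<^sub>1 H\<^sub>1"
    using P1.AE_prob_1[OF conical] by simp
  ultimately have "AE x in \<mu>\<^sub>1. x \<notin> E"
  proof eventually_elim
    case (elim x)
    obtain R \<gamma> g where R: "R > 0" "\<gamma> \<in> \<Gamma>\<^sub>1" "escaping g"
      and g: "\<And>n. n \<ge> 1 \<Longrightarrow> g n \<in> H\<^sub>1 (real n) \<and> x \<in> \<gamma> ` shadow\<^sub>1 R (g n)"
      using elim(2) unfolding conical_limit_set_def by blast
    have "inv_into UNIV \<gamma> x \<in> shadow\<^sub>1 R (g n)" if "n \<ge> 1" for n
      using g[OF that] R(2) by auto
    then have "inv_into UNIV \<gamma> x \<in> P1.radial_limit_set R"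
      using R(3) g by (auto simp: P1.radial_limit_set_def)
    moreover have "R \<le> real (Suc (nat \<lceil>R\<rceil>))" by linarith
    ultimately have "inv_into UNIV \<gamma> x \<in> P1.radial_limit_set (real (Suc (nat \<lceil>R\<rceil>)))"
      using P1.radial_limit_set_mono[OF R(1)] by blast
    then show ?case using elim(1) R(2) by blast
  qed
  then show False using nonnull by contradiction
qed

lemma magnitudes_bounded:
  assumes conical: "measure \<mu>\<^sub>1 (conical_limit_set \<Gamma>\<^sub>1 shadow\<^sub>1 H\<^sub>1) = 1"
    and nonsing: "\<not> mutually_singular (distr (restrict_space \<mu>\<^sub>1 Y) borel f) \<mu>\<^sub>2"
  obtains B where "\<And>\<gamma>. \<gamma> \<in> \<Gamma>\<^sub>1 \<Longrightarrow> \<bar>\<delta>\<^sub>1 * mag\<^sub>1 \<gamma> - \<delta>\<^sub>2 * mag\<^sub>2 (\<rho> \<gamma>)\<bar> \<le> B"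
proof -
  obtain E u C where E: "E \<in> sets borel" "E \<subseteq> Y" and u: "u \<in> borel_measurable borel"
    and nonnull: "\<not> (AE x in \<mu>\<^sub>1. x \<notin> E)"
    and transfer: "\<And>P. AE y in \<mu>\<^sub>2. P y \<Longrightarrow> AE x in \<mu>\<^sub>1. x \<in> E \<longrightarrow> P (f x)"
    and invariant: "\<And>\<gamma>. \<gamma> \<in> \<Gamma>\<^sub>1 \<Longrightarrow> AE x in \<mu>\<^sub>1. \<gamma> x \<in> E \<longrightarrow> x \<in> E"
    and cocycle: "\<And>\<gamma>. \<gamma> \<in> \<Gamma>\<^sub>1 \<Longrightarrow> AE x in \<mu>\<^sub>1. x \<in> E \<longrightarrow> \<gamma> x \<in> E \<longrightarrow>
        \<bar>\<delta>\<^sub>1 * \<sigma>\<^sub>1 \<gamma> x - \<delta>\<^sub>2 * \<sigma>\<^sub>2 (\<rho> \<gamma>) (f x) + (u (\<gamma> x) - u x)\<bar> \<le> C"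
    by (rule transfer_cocycle[OF nonsing]) blast
  obtain R\<^sub>0 F where F: "finite F" "F \<subseteq> \<Gamma>\<^sub>1" and "R\<^sub>0 > 0"
    and cover: "\<And>R \<gamma> y. R \<ge> R\<^sub>0 \<Longrightarrow> \<gamma> \<in> \<Gamma>\<^sub>1 \<Longrightarrow> y \<in> Y \<Longrightarrow>
      \<exists>g\<in>F. g y \<in> P1.pullback_shadow R \<gamma> \<and> f (g y) \<in> P2.pullback_shadow R (\<rho> \<gamma>)"
    by (rule common_pullback_cover) blast
  obtain k where k: "\<not> (AE x in \<mu>\<^sub>1. \<not> (x \<in> E \<and> x \<in> P1.radial_limit_set (real (Suc k))))"
    by (rule conical_nonnull[OF conical nonnull invariant]) blast
  \<comment> \<open>One radius must serve both the common cover and the radial limit set.\<close>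
  define R where "R = max R\<^sub>0 (real (Suc k))"
  have R: "R > 0" "R \<ge> R\<^sub>0" using \<open>R\<^sub>0 > 0\<close> by (auto simp: R_def)
  \<comment> \<open>\<open>E\<close> is the countable union of its level sets, so one of them
    contains a non-null set of radial points.\<close>
  have "\<exists>l::nat. \<not> (AE x in \<mu>\<^sub>1. \<not> (x \<in> {x \<in> E. \<bar>u x\<bar> \<le> real l} \<and> x \<in> P1.radial_limit_set R))"
  proof (rule ccontr)
    assume "\<not> ?thesis"
    then have "AE x in \<mu>\<^sub>1. \<forall>l::nat. \<not> (x \<in> {x \<in> E. \<bar>u x\<bar> \<le> real l} \<and> x \<in> P1.radial_limit_set R)"
      unfolding AE_all_countable by blast
    then have "AE x in \<mu>\<^sub>1. \<not> (x \<in> E \<and> x \<in> P1.radial_limit_set (real (Suc k)))"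
    proof eventually_elim
      case (elim x)
      have "\<bar>u x\<bar> \<le> real (nat \<lceil>\<bar>u x\<bar>\<rceil>)" by linarith
      moreover have "P1.radial_limit_set (real (Suc k)) \<subseteq> P1.radial_limit_set R"
        by (rule P1.radial_limit_set_mono) (auto simp: R_def)
      ultimately show ?case using elim by blast
    qed
    then show False using k by contradiction
  qed
  then obtain l :: nat where l: "\<not> (AE x in \<mu>\<^sub>1. \<not> (x \<in> {x \<in> E. \<bar>u x\<bar> \<le> real l} \<and> x \<in> P1.radial_limit_set R))"
    by blast
  define D where "D = {x \<in> E. \<bar>u x\<bar> \<le> real l}"
  have D: "D \<in> sets borel"
  proof -
    note [measurable] = u E(1)
    have "{x \<in> space borel. x \<in> E \<and> \<bar>u x\<bar> \<le> real l} \<in> sets borel" by measurable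
    then show ?thesis by (simp add: D_def)
  qed
  obtain K where K: "K > 0" "\<And>A. A \<in> sets borel \<Longrightarrow> P1.prob (\<Union>g\<in>F. g -` A) \<le> K * P1.prob A"
    by (rule P1.measure_translates_le[OF F]) blast
  obtain C1 where C1: "\<And>\<gamma>. \<gamma> \<in> \<Gamma>\<^sub>1 \<Longrightarrow> AE x in \<mu>\<^sub>1. x \<in> P1.pullback_shadow R \<gamma> \<longrightarrow>
        mag\<^sub>1 \<gamma> - C1 \<le> \<sigma>\<^sub>1 \<gamma> x \<and> \<sigma>\<^sub>1 \<gamma> x \<le> mag\<^sub>1 \<gamma> + C1"
    using P1.PS2[OF R(1)] unfolding P1.pullback_shadow_def by blast
  obtain C2 where C2: "\<And>\<gamma>. \<gamma> \<in> \<Gamma>\<^sub>2 \<Longrightarrow> AE x in \<mu>\<^sub>2. x \<in> P2.pullback_shadow R \<gamma> \<longrightarrow>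
        mag\<^sub>2 \<gamma> - C2 \<le> \<sigma>\<^sub>2 \<gamma> x \<and> \<sigma>\<^sub>2 \<gamma> x \<le> mag\<^sub>2 \<gamma> + C2"
    using P2.PS2[OF R(1)] unfolding P2.pullback_shadow_def by blast
  define C3 where "C3 = \<delta>\<^sub>1 * C1 + \<delta>\<^sub>2 * C2"
  have mag_approx: "AE x in \<mu>\<^sub>1. x \<in> E \<longrightarrow> x \<in> P1.pullback_shadow R \<gamma> \<longrightarrow> f x \<in> P2.pullback_shadow R (\<rho> \<gamma>) \<longrightarrow>
      \<bar>(\<delta>\<^sub>1 * \<sigma>\<^sub>1 \<gamma> x - \<delta>\<^sub>2 * \<sigma>\<^sub>2 (\<rho> \<gamma>) (f x)) - (\<delta>\<^sub>1 * mag\<^sub>1 \<gamma> - \<delta>\<^sub>2 * mag\<^sub>2 (\<rho> \<gamma>))\<bar> \<le> C3"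
    if \<gamma>: "\<gamma> \<in> \<Gamma>\<^sub>1" for \<gamma>
    using C1[OF \<gamma>] transfer[OF C2[OF \<rho>_mem[OF \<gamma>]]]
  proof eventually_elim
    case (elim x)
    show ?case
    proof (intro impI)
      assume x: "x \<in> E" "x \<in> P1.pullback_shadow R \<gamma>" "f x \<in> P2.pullback_shadow R (\<rho> \<gamma>)"
      then have "\<bar>\<sigma>\<^sub>1 \<gamma> x - mag\<^sub>1 \<gamma>\<bar> \<le> C1" "\<bar>\<sigma>\<^sub>2 (\<rho> \<gamma>) (f x) - mag\<^sub>2 (\<rho> \<gamma>)\<bar> \<le> C2"
        using elim by auto
      then have "\<bar>\<delta>\<^sub>1 * (\<sigma>\<^sub>1 \<gamma> x - mag\<^sub>1 \<gamma>)\<bar> \<le> \<delta>\<^sub>1 * C1"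
        "\<bar>\<delta>\<^sub>2 * (\<sigma>\<^sub>2 (\<rho> \<gamma>) (f x) - mag\<^sub>2 (\<rho> \<gamma>))\<bar> \<le> \<delta>\<^sub>2 * C2"
        using P1.dim_nonneg P2.dim_nonneg by (auto simp: abs_mult intro: mult_left_mono)
      then show "\<bar>(\<delta>\<^sub>1 * \<sigma>\<^sub>1 \<gamma> x - \<delta>\<^sub>2 * \<sigma>\<^sub>2 (\<rho> \<gamma>) (f x)) - (\<delta>\<^sub>1 * mag\<^sub>1 \<gamma> - \<delta>\<^sub>2 * mag\<^sub>2 (\<rho> \<gamma>))\<bar> \<le> C3"
        unfolding C3_def right_diff_distrib by linarith
    qed
  qed
  \<comment> \<open>PS1 in both systems, the second one transferred along \<open>f\<close>, bounds
    the cocycles of a fixed element. Hence \<open>u\<close> moves by a bounded amount under the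
    finitely many elements of \<open>F\<close>.\<close>
  have "\<exists>b. AE x in \<mu>\<^sub>1. x \<in> E \<longrightarrow> \<bar>\<delta>\<^sub>1 * \<sigma>\<^sub>1 g x - \<delta>\<^sub>2 * \<sigma>\<^sub>2 (\<rho> g) (f x)\<bar> \<le> b" if g: "g \<in> \<Gamma>\<^sub>1" for g
  proof -
    obtain c1 where c1: "AE x in \<mu>\<^sub>1. \<bar>\<sigma>\<^sub>1 g x\<bar> \<le> c1" using P1.PS1[OF g] by blast
    obtain c2 where c2: "AE y in \<mu>\<^sub>2. \<bar>\<sigma>\<^sub>2 (\<rho> g) y\<bar> \<le> c2" using P2.PS1[OF \<rho>_mem[OF g]] by blast
    have "AE x in \<mu>\<^sub>1. x \<in> E \<longrightarrow> \<bar>\<delta>\<^sub>1 * \<sigma>\<^sub>1 g x - \<delta>\<^sub>2 * \<sigma>\<^sub>2 (\<rho> g) (f x)\<bar> \<le> \<delta>\<^sub>1 * c1 + \<delta>\<^sub>2 * c2"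
      using c1 transfer[OF c2]
    proof eventually_elim
      case (elim x)
      show ?case
      proof
        assume "x \<in> E"
        then have "\<bar>\<delta>\<^sub>1 * \<sigma>\<^sub>1 g x\<bar> \<le> \<delta>\<^sub>1 * c1" "\<bar>\<delta>\<^sub>2 * \<sigma>\<^sub>2 (\<rho> g) (f x)\<bar> \<le> \<delta>\<^sub>2 * c2"
          using elim P1.dim_nonneg P2.dim_nonneg by (auto simp: abs_mult intro: mult_left_mono)
        then show "\<bar>\<delta>\<^sub>1 * \<sigma>\<^sub>1 g x - \<delta>\<^sub>2 * \<sigma>\<^sub>2 (\<rho> g) (f x)\<bar> \<le> \<delta>\<^sub>1 * c1 + \<delta>\<^sub>2 * c2" by linarith
      qed
    qed
    then show ?thesis by blast
  qed
  then obtain b where b: "\<And>g. g \<in> \<Gamma>\<^sub>1 \<Longrightarrow> AE x in \<mu>\<^sub>1. x \<in> E \<longrightarrow> \<bar>\<delta>\<^sub>1 * \<sigma>\<^sub>1 g x - \<delta>\<^sub>2 * \<sigma>\<^sub>2 (\<rho> g) (f x)\<bar> \<le> b g"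
    by metis
  define C4 where "C4 = (\<Sum>g\<in>F. \<bar>b g\<bar>)"
  have translate: "AE x in \<mu>\<^sub>1. \<forall>g\<in>F. g x \<in> E \<longrightarrow> x \<in> E \<and> \<bar>u (g x) - u x\<bar> \<le> C + C4"
  proof (rule AE_finite_allI[OF F(1)])
    fix g assume "g \<in> F"
    then have g: "g \<in> \<Gamma>\<^sub>1" and "\<bar>b g\<bar> \<le> C4" using F by (auto simp: C4_def intro: member_le_sum)
    show "AE x in \<mu>\<^sub>1. g x \<in> E \<longrightarrow> x \<in> E \<and> \<bar>u (g x) - u x\<bar> \<le> C + C4"
      using invariant[OF g] cocycle[OF g] b[OF g]
      by eventually_elim (use \<open>\<bar>b g\<bar> \<le> C4\<close> in \<open>auto simp: abs_le_iff\<close>)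
  qed
  \<comment> \<open>The errors that add up: \<open>C + C4\<close> from \<open>x\<close> to
    \<open>g x\<close>, \<open>C\<close> for the cocycle comparison at \<open>\<gamma>\<close>,
    \<open>real l\<close> for the value of \<open>u\<close> at \<open>\<gamma> (g x)\<close> in
    \<open>D\<close>, and \<open>C3\<close> for replacing cocycles by magnitudes.\<close>
  define B where "B = C + C4 + C + real l + C3"
  define good where "good t c = {x \<in> E. \<bar>u x - t\<bar> \<le> c}" for t c
  have good_sets: "good t c \<in> sets \<mu>\<^sub>1" for t c
  proof -
    note [measurable] = u E(1)
    have "{x \<in> space borel. x \<in> E \<and> \<bar>u x - t\<bar> \<le> c} \<in> sets borel" by measurable
    then show ?thesis by (simp add: good_def P1.sets_eq)
  qed
  \<comment> \<open>The centre \<open>t\<close> is the difference of magnitudes for a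
    \<open>\<gamma>\<close> chosen after \<open>e\<close>, so it depends on \<open>e\<close>.
    Density is requested up to \<open>e / K\<close> since translating by \<open>F\<close> costs the
    factor \<open>K\<close>.\<close>
  have key: "\<exists>t. P1.prob (- good t B) \<le> e" if "e > 0" for e
  proof -
    have "e / K > 0" using that K(1) by simp
    then obtain \<gamma> where \<gamma>: "\<gamma> \<in> \<Gamma>\<^sub>1" and small: "P1.prob (P1.pullback_shadow R \<gamma> - \<gamma> -` D) \<le> e / K"
      using P1.pulled_back_density[OF R(1) D _ l[folded D_def]] by blast
    define t where "t = \<delta>\<^sub>1 * mag\<^sub>1 \<gamma> - \<delta>\<^sub>2 * mag\<^sub>2 (\<rho> \<gamma>)"
    define bad where "bad = (\<Union>g\<in>F. g -` (P1.pullback_shadow R \<gamma> - \<gamma> -` D))"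
    have meas: "P1.pullback_shadow R \<gamma> - \<gamma> -` D \<in> sets borel"
      using P1.sets_pullback_shadow[OF \<gamma> R(1)] P1.vimage_borel[OF \<gamma> D] by blast
    have bad_sets: "bad \<in> sets \<mu>\<^sub>1"
      unfolding bad_def P1.sets_eq using F P1.vimage_borel[OF _ meas] by (intro sets.finite_UN) auto
    \<comment> \<open>Some \<open>g\<close> in \<open>F\<close> moves \<open>x\<close> into both
      pulled-back shadows. Outside \<open>bad\<close> the point \<open>\<gamma> (g x)\<close> lies
      in \<open>D\<close>; invariance brings first \<open>g x\<close> and then \<open>x\<close> into
      \<open>E\<close>, and \<open>u\<close> is compared along these three points.\<close>
    have "AE x in \<mu>\<^sub>1. x \<notin> good t B \<longrightarrow> x \<in> bad"
      using Y_full translate P1.AE_comp_finite[OF F invariant[OF \<gamma>]]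
        P1.AE_comp_finite[OF F cocycle[OF \<gamma>]] P1.AE_comp_finite[OF F mag_approx[OF \<gamma>]]
    proof eventually_elim
      case (elim x)
      obtain g where g: "g \<in> F" "g x \<in> P1.pullback_shadow R \<gamma>" "f (g x) \<in> P2.pullback_shadow R (\<rho> \<gamma>)"
        using cover[OF R(2) \<gamma> elim(1)] by blast
      show ?case
      proof (cases "\<gamma> (g x) \<in> D")
        case True
        then have \<gamma>gx: "\<gamma> (g x) \<in> E" "\<bar>u (\<gamma> (g x))\<bar> \<le> real l" by (auto simp: D_def)
        then have gx: "g x \<in> E" using elim(3) g(1) by blast
        then have x: "x \<in> E" "\<bar>u (g x) - u x\<bar> \<le> C + C4" using elim(2) g(1) by auto
        have "\<bar>\<delta>\<^sub>1 * \<sigma>\<^sub>1 \<gamma> (g x) - \<delta>\<^sub>2 * \<sigma>\<^sub>2 (\<rho> \<gamma>) (f (g x)) + (u (\<gamma> (g x)) - u (g x))\<bar> \<le> C"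
          using elim(4) g(1) gx \<gamma>gx by blast
        moreover have "\<bar>\<delta>\<^sub>1 * \<sigma>\<^sub>1 \<gamma> (g x) - \<delta>\<^sub>2 * \<sigma>\<^sub>2 (\<rho> \<gamma>) (f (g x)) - t\<bar> \<le> C3"
          unfolding t_def using elim(5) g gx by blast
        ultimately have "\<bar>u x - t\<bar> \<le> B" using x(2) \<gamma>gx(2) unfolding B_def by linarith
        then show ?thesis using x(1) by (simp add: good_def)
      next
        case False
        then show ?thesis using g by (auto simp: bad_def)
      qed
    qed
    then have "P1.prob (- good t B) \<le> P1.prob bad"
      using bad_sets by (intro P1.finite_measure_mono_AE) auto
    also have "\<dots> \<le> K * P1.prob (P1.pullback_shadow R \<gamma> - \<gamma> -` D)"
      unfolding bad_def by (rule K(2)[OF meas])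
    also have "\<dots> \<le> e" using small K(1) by (simp add: field_simps)
    finally show ?thesis by blast
  qed
  have compl: "- good t c \<in> sets \<mu>\<^sub>1" for t c
    using sets.compl_sets[OF good_sets] by (simp add: P1.space_eq Compl_eq_Diff_UNIV)
  obtain t where t: "P1.prob (- good t B) \<le> 1/4" using key[of "1/4"] by auto
  \<comment> \<open>Keep the centre \<open>t\<close> fixed. Two sets with complements of measure at
    most 1/4 must meet, so any better centre \<open>s\<close> lies within \<open>2 * B\<close> of
    \<open>t\<close>, and the radius \<open>3 * B\<close> about \<open>t\<close> contains the band
    of radius \<open>B\<close> about \<open>s\<close>.\<close>
  have vanish: "P1.prob (- good t (3 * B)) \<le> e" if e: "0 < e" "e \<le> 1/4" for e
  proof -
    obtain s where s: "P1.prob (- good s B) \<le> e" using key[OF e(1)] by blast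
    have "good t B \<inter> good s B \<noteq> {}"
    proof
      assume "good t B \<inter> good s B = {}"
      then have "- good t B \<union> - good s B = UNIV" by blast
      then have "1 \<le> P1.prob (- good t B) + P1.prob (- good s B)"
        using measure_Un_le[OF compl compl, of t B s B] P1.prob_space by (simp add: P1.space_eq)
      then show False using s t e by linarith
    qed
    then have "\<bar>s - t\<bar> \<le> 2 * B" unfolding good_def by force
    then have "good s B \<subseteq> good t (3 * B)" unfolding good_def by force
    then have "P1.prob (- good t (3 * B)) \<le> P1.prob (- good s B)"
      using compl by (intro P1.finite_measure_mono) auto
    then show ?thesis using s by simp
  qed
  have "P1.prob (- good t (3 * B)) = 0"
  proof (rule ccontr)
    let ?p = "P1.prob (- good t (3 * B))"
    assume "?p \<noteq> 0"
    then have "?p > 0" using measure_nonneg[of \<mu>\<^sub>1 "- good t (3 * B)"] by linarith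
    then have "?p \<le> min (?p / 2) (1/4)" by (intro vanish) auto
    then show False using \<open>?p > 0\<close> by linarith
  qed
  then have "- good t (3 * B) \<in> null_sets \<mu>\<^sub>1"
    using compl by (auto simp: null_sets_def P1.emeasure_eq_measure)
  from AE_not_in[OF this] have u_bounded: "AE x in \<mu>\<^sub>1. x \<in> good t (3 * B)" by eventually_elim auto
  show thesis
  proof (rule that)
    fix \<gamma> assume \<gamma>: "\<gamma> \<in> \<Gamma>\<^sub>1"
    \<comment> \<open>The band around \<open>t\<close> has width \<open>6 * B\<close>, which bounds
      the change of \<open>u\<close> from \<open>g x\<close> to \<open>\<gamma> (g x)\<close>;
      \<open>C\<close> and \<open>C3\<close> are the errors of the cocycle comparison and of
      PS2.\<close>
    have "AE x in \<mu>\<^sub>1. \<bar>\<delta>\<^sub>1 * mag\<^sub>1 \<gamma> - \<delta>\<^sub>2 * mag\<^sub>2 (\<rho> \<gamma>)\<bar> \<le> C + 6 * B + C3"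
      using Y_full P1.AE_comp_finite[OF F u_bounded] P1.AE_comp_finite[OF F P1.AE_comp[OF \<gamma> u_bounded]]
        P1.AE_comp_finite[OF F cocycle[OF \<gamma>]] P1.AE_comp_finite[OF F mag_approx[OF \<gamma>]]
    proof eventually_elim
      case (elim x)
      obtain g where g: "g \<in> F" "g x \<in> P1.pullback_shadow R \<gamma>" "f (g x) \<in> P2.pullback_shadow R (\<rho> \<gamma>)"
        using cover[OF R(2) \<gamma> elim(1)] by blast
      then have E: "g x \<in> E" "\<gamma> (g x) \<in> E" and "\<bar>u (g x) - t\<bar> \<le> 3 * B" "\<bar>u (\<gamma> (g x)) - t\<bar> \<le> 3 * B"
        using elim(2,3) by (auto simp: good_def)
      moreover have "\<bar>\<delta>\<^sub>1 * \<sigma>\<^sub>1 \<gamma> (g x) - \<delta>\<^sub>2 * \<sigma>\<^sub>2 (\<rho> \<gamma>) (f (g x)) + (u (\<gamma> (g x)) - u (g x))\<bar> \<le> C"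
        using elim(4) g(1) E by blast
      moreover have "\<bar>\<delta>\<^sub>1 * \<sigma>\<^sub>1 \<gamma> (g x) - \<delta>\<^sub>2 * \<sigma>\<^sub>2 (\<rho> \<gamma>) (f (g x)) - (\<delta>\<^sub>1 * mag\<^sub>1 \<gamma> - \<delta>\<^sub>2 * mag\<^sub>2 (\<rho> \<gamma>))\<bar> \<le> C3"
        using elim(5) g E by blast
      ultimately show ?case by linarith
    qed
    \<comment> \<open>The inequality does not involve \<open>x\<close>, and an almost sure constant
      statement under a probability measure is true.\<close>
    then show "\<bar>\<delta>\<^sub>1 * mag\<^sub>1 \<gamma> - \<delta>\<^sub>2 * mag\<^sub>2 (\<rho> \<gamma>)\<bar> \<le> C + 6 * B + C3" by simp
  qed
qed

end

theorem theorem1p26: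
  fixes \<Gamma>\<^sub>1 :: "('a::metric_space \<Rightarrow> 'a) set"
    and \<Gamma>\<^sub>2 :: "('b::metric_space \<Rightarrow> 'b) set"
    and \<sigma>\<^sub>1 :: "('a \<Rightarrow> 'a) \<Rightarrow> 'a \<Rightarrow> real"
    and \<sigma>\<^sub>2 :: "('b \<Rightarrow> 'b) \<Rightarrow> 'b \<Rightarrow> real"
    and \<mu>\<^sub>1 :: "'a measure" and \<mu>\<^sub>2 :: "'b measure"
    and \<delta>\<^sub>1 \<delta>\<^sub>2 :: real
    and mag\<^sub>1 :: "('a \<Rightarrow> 'a) \<Rightarrow> real" and mag\<^sub>2 :: "('b \<Rightarrow> 'b) \<Rightarrow> real"
    and shadow\<^sub>1 :: "real \<Rightarrow> ('a \<Rightarrow> 'a) \<Rightarrow> 'a set"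
    and shadow\<^sub>2 :: "real \<Rightarrow> ('b \<Rightarrow> 'b) \<Rightarrow> 'b set"
    and H\<^sub>1 :: "real \<Rightarrow> ('a \<Rightarrow> 'a) set"
    and \<rho> :: "('a \<Rightarrow> 'a) \<Rightarrow> ('b \<Rightarrow> 'b)"
    and Y :: "'a set" and f :: "'a \<Rightarrow> 'b"
  assumes "well_behaved_PS_system \<Gamma>\<^sub>1 \<sigma>\<^sub>1 \<mu>\<^sub>1 \<delta>\<^sub>1 mag\<^sub>1 shadow\<^sub>1 H\<^sub>1"
    and "measure \<mu>\<^sub>1 (conical_limit_set \<Gamma>\<^sub>1 shadow\<^sub>1 H\<^sub>1) = 1"
    and "PS_system \<Gamma>\<^sub>2 \<sigma>\<^sub>2 \<mu>\<^sub>2 \<delta>\<^sub>2 mag\<^sub>2 shadow\<^sub>2"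
    and "\<rho> \<in> epi (homeo_group\<lparr>carrier := \<Gamma>\<^sub>1\<rparr>) (homeo_group\<lparr>carrier := \<Gamma>\<^sub>2\<rparr>)"
    and "ae_equivariant_injection \<Gamma>\<^sub>1 \<mu>\<^sub>1 \<rho> Y f"
    and "\<not> mutually_singular (distr (restrict_space \<mu>\<^sub>1 Y) borel f) \<mu>\<^sub>2"
  shows "(SUP \<gamma>\<in>\<Gamma>\<^sub>1. ereal \<bar>\<delta>\<^sub>1 * mag\<^sub>1 \<gamma> - \<delta>\<^sub>2 * mag\<^sub>2 (\<rho> \<gamma>)\<bar>) < \<infinity>"
proof -
  interpret PS_pair \<Gamma>\<^sub>1 \<sigma>\<^sub>1 \<mu>\<^sub>1 \<delta>\<^sub>1 mag\<^sub>1 shadow\<^sub>1 H\<^sub>1 \<Gamma>\<^sub>2 \<sigma>\<^sub>2 \<mu>\<^sub>2 \<delta>\<^sub>2 mag\<^sub>2 shadow\<^sub>2 \<rho> Y f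
    using assms by (intro PS_pair.intro PS_pair_axioms.intro)
  obtain B where "\<And>\<gamma>. \<gamma> \<in> \<Gamma>\<^sub>1 \<Longrightarrow> \<bar>\<delta>\<^sub>1 * mag\<^sub>1 \<gamma> - \<delta>\<^sub>2 * mag\<^sub>2 (\<rho> \<gamma>)\<bar> \<le> B"
    using magnitudes_bounded[OF assms(2,6)] by blast
  then have "(SUP \<gamma>\<in>\<Gamma>\<^sub>1. ereal \<bar>\<delta>\<^sub>1 * mag\<^sub>1 \<gamma> - \<delta>\<^sub>2 * mag\<^sub>2 (\<rho> \<gamma>)\<bar>) \<le> ereal B"
    by (intro SUP_least) simp
  also have "\<dots> < \<infinity>" by simp
  finally show ?thesis .
qed

end
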